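(* For all real $0 < \alpha < 1$ and all $r \in \mathbb{N}$, \[ N^{\mathbb{R}}_\alpha(r) \leq \max\left( \binom{1/\alpha^2 - 1}{2},\, 2r \right). \] Moreover, suppose $\alpha \leq 1/7$ and define $r_\alpha = \frac{1}{2} \binom{1/\alpha^2 - 1}{2} + \frac{(1+\alpha)^2}{16 \alpha^2}$. Then for all $r \in \mathbb{N}$ with $r \leq r_\alpha$, \[ N^{\mathbb{R}}_{\alpha}(r) \leq \binom{1/\alpha^2 - 1}{2}, \] with equality only if the corresponding lines (i.e. any family of $N^{\mathbb{R}}_\alpha(r)$ equiangular lines in $\mathbb{R}^r$ with common angle $\arccos(\alpha)$) span a $(1/\alpha^2 - 2)$-dimensional subspace. Furthermore, for all $r \in \mathbb{N}$ with $r > r_\alpha$, \[ N^{\mathbb{R}}_{\alpha}(r) \leq 2r - \frac{(1+\alpha)^2}{8 \alpha^2}. \]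
   Context: $\mathbb{N}$ is the set of positive integers. Lines $l_1,\dots,l_n$ through the origin in $\mathbb{R}^r$ are equiangular with common angle $\arccos(\alpha)$ if, choosing a unit vector $v_i$ along each $l_i$, one has $|\langle v_i, v_j\rangle| = \alpha$ for all $i \neq j$. $N^{\mathbb{R}}_\alpha(r)$ denotes the maximum number of equiangular lines in $\mathbb{R}^r$ with common angle $\arccos(\alpha)$. For real $y$, $\binom{y}{2} = y(y-1)/2$. *)

theory Defs
  imports "HOL-Analysis.Analysis"
begin

text \<open>
  For \<open>\<alpha> < 1\<close> the lines of an equiangular family are automatically distinct (a repeated line would
  give inner product \<open>1\<close>), so families are modelled as finite sets of lines.
  A one-dimensional subspace contains exactly two unit vectors, \<open>v\<close> and \<open>-v\<close>, so the choice of
  unit vectors is immaterial and we quantify over all choices.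
\<close>

definition equiangular_lines :: "real \<Rightarrow> (real ^ 'r) set set \<Rightarrow> bool" where
  "equiangular_lines \<alpha> L \<longleftrightarrow>
     finite L \<and>
     (\<forall>l\<in>L. subspace l \<and> dim l = 1) \<and>
     (\<forall>l\<in>L. \<forall>m\<in>L. l \<noteq> m \<longrightarrow>
        (\<forall>v\<in>l. \<forall>w\<in>m. norm v = 1 \<longrightarrow> norm w = 1 \<longrightarrow> \<bar>v \<bullet> w\<bar> = \<alpha>))"

text \<open>
  The dimension \<open>r\<close> of the ambient space is \<open>CARD('r)\<close>. The maximum is over a nonempty finite set
  when \<open>0 < \<alpha> < 1\<close>; see \<open>finite_equiangular_cards\<close> below.
\<close>

definition max_equiangular :: "'r::finite itself \<Rightarrow> real \<Rightarrow> nat" where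
  "max_equiangular _ \<alpha> = Max {card L |L :: (real ^ 'r) set set. equiangular_lines \<alpha> L}"

definition r_alpha :: "real \<Rightarrow> real" where
  "r_alpha \<alpha> = 1 / 2 * ((1 / \<alpha>\<^sup>2 - 1) gchoose 2) + (1 + \<alpha>)\<^sup>2 / (16 * \<alpha>\<^sup>2)"

lemma gchoose_2_real: "(y::real) gchoose 2 = y * (y - 1) / 2"
  by (simp add: gbinomial_prod_rev numeral_2_eq_2)

lemma unit_vector_exists:
  fixes l :: "(real ^ 'r) set"
  assumes "subspace l" "dim l = 1"
  shows "\<exists>v\<in>l. norm v = 1"
proof -
  have "\<not> l \<subseteq> {0}"
    using assms(2) dim_eq_0[of l] by simp
  then obtain x where x: "x \<in> l" "x \<noteq> 0"
    by auto
  then have "(1 / norm x) *\<^sub>R x \<in> l"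
    using assms(1) by (simp add: subspace_scale)
  moreover have "norm ((1 / norm x) *\<^sub>R x) = 1"
    using x(2) by simp
  ultimately show ?thesis by blast
qed

lemma equiangular_card_bounded:
  assumes "\<alpha> < 1"
  shows "\<exists>B. \<forall>L :: (real ^ 'r) set set. equiangular_lines \<alpha> L \<longrightarrow> card L \<le> B"
proof -
  define d where "d = sqrt (2 - 2 * \<alpha>)"
  have d: "d > 0" "d\<^sup>2 = 2 - 2 * \<alpha>"
    using assms by (auto simp: d_def)
  have "compact (sphere (0 :: real ^ 'r) 1)" by simp
  then obtain K where K: "finite K" "sphere (0 :: real ^ 'r) 1 \<subseteq> (\<Union>x\<in>K. ball x (d / 2))"
    using d(1) compact_imp_seq_compact seq_compact_imp_totally_bounded
    by (metis half_gt_zero)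
  have "card L \<le> card K" if L: "equiangular_lines \<alpha> L" for L :: "(real ^ 'r) set set"
  proof -
    have "\<forall>l\<in>L. \<exists>v\<in>l. norm v = 1"
      using L unit_vector_exists unfolding equiangular_lines_def by blast
    then obtain v where v: "\<And>l. l \<in> L \<Longrightarrow> v l \<in> l \<and> norm (v l) = 1"
      by metis
    have "\<forall>l\<in>L. \<exists>x\<in>K. dist x (v l) < d / 2"
      using K(2) v by (fastforce simp: subset_iff)
    then obtain c where c: "\<And>l. l \<in> L \<Longrightarrow> c l \<in> K \<and> dist (c l) (v l) < d / 2"
      by metis
    have "inj_on c L"
    proof (rule inj_onI, rule ccontr)
      fix l m assume lm: "l \<in> L" "m \<in> L" "c l = c m" "l \<noteq> m"
      have "\<bar>v l \<bullet> v m\<bar> = \<alpha>"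
        using L lm v unfolding equiangular_lines_def by blast
      moreover have "(dist (v l) (v m))\<^sup>2 = 2 - 2 * (v l \<bullet> v m)"
        using v lm(1,2)
        by (simp add: dist_norm power2_norm_eq_inner inner_diff inner_commute norm_eq_1)
      ultimately have "d\<^sup>2 \<le> (dist (v l) (v m))\<^sup>2"
        using d(2) by linarith
      then have "d \<le> dist (v l) (v m)"
        by (rule power2_le_imp_le) simp
      moreover have "dist (v l) (v m) < d"
        using c[OF lm(1)] c[OF lm(2)] lm(3) dist_triangle_half_r[of "c l" "v l" d "v m"]
        by simp
      ultimately show False by simp
    qed
    then show ?thesis
      using c K(1) by (intro card_inj_on_le[of c]) auto
  qed
  then show ?thesis by blast
qed

lemma finite_equiangular_cards:
  assumes "\<alpha> < 1"
  shows "finite {card L |L :: (real ^ 'r) set set. equiangular_lines \<alpha> L}"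
proof -
  obtain B where "\<And>L :: (real ^ 'r) set set. equiangular_lines \<alpha> L \<Longrightarrow> card L \<le> B"
    using equiangular_card_bounded[OF assms] by blast
  then have "{card L |L :: (real ^ 'r) set set. equiangular_lines \<alpha> L} \<subseteq> {..B}"
    by auto
  then show ?thesis
    using finite_subset by blast
qed

lemma max_equiangular_attained:
  assumes "\<alpha> < 1"
  shows "\<exists>L :: (real ^ 'r::finite) set set. equiangular_lines \<alpha> L \<and> card L = max_equiangular TYPE('r) \<alpha>"
proof -
  have "equiangular_lines \<alpha> ({} :: (real ^ 'r) set set)"
    by (simp add: equiangular_lines_def)
  then have "{card L |L :: (real ^ 'r) set set. equiangular_lines \<alpha> L} \<noteq> {}"
    by blast
  from Max_in[OF finite_equiangular_cards[OF assms] this] show ?thesis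
    unfolding max_equiangular_def by (auto simp: eq_commute)
qed

lemma card_le_max_equiangular:
  fixes L :: "(real ^ 'r::finite) set set"
  assumes "\<alpha> < 1" "equiangular_lines \<alpha> L"
  shows "card L \<le> max_equiangular TYPE('r) \<alpha>"
  unfolding max_equiangular_def
  using assms by (intro Max_ge finite_equiangular_cards) auto

end

theory Submission
  imports Defs
begin

text \<open>
  Let \<open>K = \<Sum> v\<^sub>i v\<^sub>i\<^sup>T\<close> for unit vectors \<open>v\<^sub>i\<close> along the lines, with top eigenvector \<open>u\<close> and top
  eigenvalue \<open>y\<close>. The matrices \<open>v\<^sub>i v\<^sub>i\<^sup>T\<close> have a two-valued Gram matrix, so projecting
  \<open>v\<^sub>j u\<^sup>T + u v\<^sub>j\<^sup>T\<close> onto their span gives an inequality between \<open>y\<close> and \<open>u \<bullet> v\<^sub>j\<close>. Averaged over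
  \<open>j\<close> it shows that, once \<open>n\<close> reaches the binomial coefficient, either all nonzero eigenvalues of
  \<open>K\<close> agree (the equality case) or \<open>y\<close> is close to its maximal possible value \<open>\<alpha> n\<close>. In the latter case it also
  bounds every \<open>u \<bullet> v\<^sub>j\<close> from below, and after choosing signs with \<open>u \<bullet> v\<^sub>j \<ge> 0\<close> the graph \<open>A\<close> of
  negative inner products has maximum degree about \<open>l\<^sup>3\<close>, where \<open>l = (1 - \<alpha>) / (2 \<alpha>)\<close>.

  Since \<open>l I + J / 2 - A\<close> is positive semidefinite, testing it on stars lowers the maximum degree to
  \<open>l\<^sup>2 + l / 4\<close>, and testing it on balls of radius two (where codegrees being integers enters) lowers
  the average degree to \<open>l\<^sup>2\<close>. The rank inequality
  \<open>(n - q)\<^sup>2 \<le> (r - 1) (tr K\<^sup>2 - q\<^sup>2)\<close> with \<open>q = u\<^sup>T K u\<close>, now for \<open>u\<close> along \<open>\<Sum> v\<^sub>i\<close>, then yields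
  \<open>n + (l + 1)\<^sup>2 / 2 < 2 r\<close>. For \<open>l < 3/2\<close> the star test is precise enough, and for \<open>l \<le> 1\<close> the graph is
  a matching, so half of the vectors are linearly independent.
\<close>

section \<open>Projections and quadratic forms\<close>

text \<open>Bessel's inequality for the span of the \<open>W i\<close>, multiplied by
  \<open>p\<close>. Their Gram matrix \<open>p I + q J\<close> has inverse
  \<open>(I - q / (p + n q) J) / p\<close>, which produces the correction term.\<close>

lemma gram_projection:
  fixes W :: "'i \<Rightarrow> 'a::real_inner" and X :: 'a and p q :: real
  assumes "p > 0" "q \<ge> 0"
    and gram: "\<And>i j. i \<in> I \<Longrightarrow> j \<in> I \<Longrightarrow> W i \<bullet> W j = (if i = j then p + q else q)"
    and fin: "finite I"
  shows "(\<Sum>i\<in>I. (X \<bullet> W i)\<^sup>2) - q / (p + card I * q) * (\<Sum>i\<in>I. X \<bullet> W i)\<^sup>2 \<le> p * (X \<bullet> X)"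
proof -
  define n :: real where "n = card I"
  define C where "C = (\<Sum>i\<in>I. X \<bullet> W i)"
  define k where "k = q * C / (p + n * q)"
  define e where "e i = X \<bullet> W i - k" for i
  define Y where "Y = p *\<^sub>R X - (\<Sum>i\<in>I. e i *\<^sub>R W i)"
  have pos: "p + n * q > 0"
    using assms by (simp add: n_def add_pos_nonneg)
  have cross: "X \<bullet> (\<Sum>i\<in>I. e i *\<^sub>R W i) = (\<Sum>i\<in>I. (X \<bullet> W i)\<^sup>2) - k * C"
    by (simp add: inner_sum_right e_def C_def sum_distrib_left algebra_simps power2_eq_square
        flip: sum_subtractf)
  have sum_e: "sum e I = C - n * k"
    by (simp add: e_def C_def n_def sum_subtractf)
  have "(\<Sum>i\<in>I. e i *\<^sub>R W i) \<bullet> (\<Sum>i\<in>I. e i *\<^sub>R W i)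
      = (\<Sum>i\<in>I. \<Sum>j\<in>I. e i * e j * (q + (if i = j then p else 0)))"
    unfolding inner_sum_left inner_sum_right
    by (intro sum.cong refl) (simp add: gram)
  also have "\<dots> = (\<Sum>i\<in>I. e i * (q * sum e I) + p * (e i)\<^sup>2)"
  proof (intro sum.cong refl)
    fix i assume "i \<in> I"
    have "(\<Sum>j\<in>I. e i * e j * (q + (if i = j then p else 0)))
        = (\<Sum>j\<in>I. e i * q * e j) + (\<Sum>j\<in>I. if i = j then p * (e i * e i) else 0)"
      unfolding sum.distrib[symmetric] by (intro sum.cong refl) (auto simp: algebra_simps)
    also have "\<dots> = e i * (q * sum e I) + p * (e i)\<^sup>2"
      using \<open>i \<in> I\<close> fin by (simp add: sum_distrib_left power2_eq_square mult.assoc)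
    finally show "(\<Sum>j\<in>I. e i * e j * (q + (if i = j then p else 0)))
        = e i * (q * sum e I) + p * (e i)\<^sup>2" .
  qed
  also have "\<dots> = q * (C - n * k)\<^sup>2 + p * (\<Sum>i\<in>I. (e i)\<^sup>2)"
    by (simp add: sum.distrib sum_e power2_eq_square flip: sum_distrib_left sum_distrib_right)
  also have "(\<Sum>i\<in>I. (e i)\<^sup>2) = (\<Sum>i\<in>I. (X \<bullet> W i)\<^sup>2) - 2 * k * C + n * k\<^sup>2"
    by (simp add: e_def power2_diff sum.distrib sum_subtractf C_def n_def sum_distrib_left
        algebra_simps)
  finally have square: "(\<Sum>i\<in>I. e i *\<^sub>R W i) \<bullet> (\<Sum>i\<in>I. e i *\<^sub>R W i)
      = q * (C - n * k)\<^sup>2 + p * ((\<Sum>i\<in>I. (X \<bullet> W i)\<^sup>2) - 2 * k * C + n * k\<^sup>2)" .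
  have "0 \<le> Y \<bullet> Y" by simp
  also have "Y \<bullet> Y = p\<^sup>2 * (X \<bullet> X) - 2 * p * (X \<bullet> (\<Sum>i\<in>I. e i *\<^sub>R W i))
      + (\<Sum>i\<in>I. e i *\<^sub>R W i) \<bullet> (\<Sum>i\<in>I. e i *\<^sub>R W i)"
    unfolding Y_def by (simp add: inner_diff inner_commute power2_eq_square algebra_simps)
  also have "\<dots> = p * (p * (X \<bullet> X) - (\<Sum>i\<in>I. (X \<bullet> W i)\<^sup>2)) + (p * n * k\<^sup>2 + q * (C - n * k)\<^sup>2)"
    unfolding cross square by (simp add: algebra_simps power2_eq_square)
  also have "p * n * k\<^sup>2 + q * (C - n * k)\<^sup>2 = p * (q / (p + n * q) * C\<^sup>2)"
  proof -
    define d where "d = p + n * q"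
    have k: "k = q * C / d" and d: "d > 0"
      using pos by (simp_all add: k_def d_def)
    have "C - n * k = p * C / d"
      using d by (simp add: k divide_simps) (simp add: d_def algebra_simps)
    then have "p * n * k\<^sup>2 + q * (C - n * k)\<^sup>2 = p * q * C\<^sup>2 * (p + n * q) / d\<^sup>2"
      using d by (simp add: k power_divide divide_simps) (simp add: algebra_simps power2_eq_square)
    also have "\<dots> = p * (q / d * C\<^sup>2)"
      using d by (simp flip: d_def add: power2_eq_square)
    finally show ?thesis by (simp add: d_def)
  qed
  finally have "0 \<le> p * (p * (X \<bullet> X) - (\<Sum>i\<in>I. (X \<bullet> W i)\<^sup>2) + q / (p + n * q) * C\<^sup>2)"
    by (simp add: algebra_simps)
  then show ?thesis
    using \<open>p > 0\<close> by (simp add: zero_le_mult_iff C_def n_def)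
qed

text \<open>The rank-one matrix \<open>x y\<^sup>T\<close>. On this nested vector type the inner
  product is the Frobenius product.\<close>

definition outer :: "real ^ 'm \<Rightarrow> real ^ 'n \<Rightarrow> real ^ 'n ^ 'm" where
  "outer x y = (\<chi> i j. x $ i * y $ j)"

lemma inner_outer: "outer x y \<bullet> outer x' y' = (x \<bullet> x') * (y \<bullet> y')"
  proof -
  have "outer x y \<bullet> outer x' y' = (\<Sum>i\<in>UNIV. \<Sum>j\<in>UNIV. (x $ i * x' $ i) * (y $ j * y' $ j))"
    by (simp add: outer_def inner_vec_def mult_ac)
  then show ?thesis
    by (simp add: inner_vec_def sum_product)
qed

section \<open>Maximisers of quadratic forms and their eigenvector equation\<close>

lemma quadratic_nonneg_linear_zero:
  fixes p q :: real
  assumes "\<And>e. 0 \<le> e * p + e\<^sup>2 * q"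
  shows "p = 0"
proof (rule ccontr)
  assume "p \<noteq> 0"
  \<comment> \<open>The step \<open>- p / Q\<close> makes the linear term dominate; adding
    \<open>1\<close> keeps \<open>Q\<close> positive and strictly above \<open>q\<close>.\<close>
  define Q where "Q = \<bar>q\<bar> + 1"
  then have Q: "Q > 0" by simp
  have "0 \<le> (- p / Q) * p + (- p / Q)\<^sup>2 * q" by (rule assms)
  also have "\<dots> = (p / Q)\<^sup>2 * (q - Q)"
    using Q by (simp add: power_divide divide_simps) (simp add: power2_eq_square algebra_simps)
  also have "\<dots> < 0"
    using \<open>p \<noteq> 0\<close> by (intro mult_pos_neg) (auto simp: Q_def)
  finally show False by simp
qed

text \<open>First-order optimality: \<open>y * (w \<bullet> w)\<close> minus the form is nonnegative
  and vanishes at \<open>u\<close>, so its derivative there in the direction of the residual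
  \<open>h\<close>, which is \<open>2 * (h \<bullet> h)\<close>, must be zero.\<close>

lemma maximizer_is_eigenvector:
  fixes v :: "'i \<Rightarrow> 'a::real_inner"
  assumes bound: "\<And>w. (\<Sum>i\<in>I. (w \<bullet> v i)\<^sup>2) \<le> y * (w \<bullet> w)"
    and attained: "(\<Sum>i\<in>I. (u \<bullet> v i)\<^sup>2) = y * (u \<bullet> u)"
  shows "(\<Sum>i\<in>I. (u \<bullet> v i) *\<^sub>R v i) = y *\<^sub>R u"
proof -
  define h where "h = y *\<^sub>R u - (\<Sum>i\<in>I. (u \<bullet> v i) *\<^sub>R v i)"
  have "0 \<le> e * (2 * (h \<bullet> h)) + e\<^sup>2 * (y * (h \<bullet> h) - (\<Sum>i\<in>I. (h \<bullet> v i)\<^sup>2))" for e :: real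
  proof -
    define S where "S = (\<Sum>i\<in>I. (u \<bullet> v i) * (h \<bullet> v i))"
    have "(\<Sum>i\<in>I. ((u + e *\<^sub>R h) \<bullet> v i)\<^sup>2)
        = y * (u \<bullet> u) + 2 * e * S + e\<^sup>2 * (\<Sum>i\<in>I. (h \<bullet> v i)\<^sup>2)"
      unfolding attained[symmetric] S_def
      by (simp add: inner_add_left power2_eq_square algebra_simps sum.distrib sum_distrib_left)
    moreover have "(u + e *\<^sub>R h) \<bullet> (u + e *\<^sub>R h) = u \<bullet> u + 2 * e * (u \<bullet> h) + e\<^sup>2 * (h \<bullet> h)"
      by (simp add: inner_add inner_commute[of h u] power2_eq_square algebra_simps)
    ultimately have "0 \<le> y * (u \<bullet> u + 2 * e * (u \<bullet> h) + e\<^sup>2 * (h \<bullet> h))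
        - (y * (u \<bullet> u) + 2 * e * S + e\<^sup>2 * (\<Sum>i\<in>I. (h \<bullet> v i)\<^sup>2))"
      using bound[of "u + e *\<^sub>R h"] by simp
    also have "\<dots> = e * (2 * (y * (u \<bullet> h) - S)) + e\<^sup>2 * (y * (h \<bullet> h) - (\<Sum>i\<in>I. (h \<bullet> v i)\<^sup>2))"
      by (simp add: algebra_simps)
    also have "y * (u \<bullet> h) - S = h \<bullet> h"
      by (subst (3) h_def)
        (simp add: S_def inner_diff_right inner_sum_right inner_commute[of u h])
    finally show ?thesis .
  qed
  from quadratic_nonneg_linear_zero[OF this] have "h = 0" by simp
  then show ?thesis by (simp add: h_def)
qed

text \<open>The maximum is taken on the compact unit sphere, and homogeneity extends the bound to
  every \<open>w\<close>.\<close>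

lemma max_quadratic_form_exists:
  fixes v :: "'i \<Rightarrow> 'a::euclidean_space"
  obtains u y where "norm u = 1" "\<And>w. (\<Sum>i\<in>I. (w \<bullet> v i)\<^sup>2) \<le> y * (w \<bullet> w)"
    "(\<Sum>i\<in>I. (u \<bullet> v i)\<^sup>2) = y"
proof -
  define f where "f w = (\<Sum>i\<in>I. (w \<bullet> v i)\<^sup>2)" for w
  have "continuous_on (sphere 0 1) f"
    unfolding f_def by (intro continuous_intros)
  moreover have "sphere (0::'a) 1 \<noteq> {}" by simp
  ultimately obtain u where u: "u \<in> sphere 0 1" "\<And>w. w \<in> sphere 0 1 \<Longrightarrow> f w \<le> f u"
    using continuous_attains_sup[of "sphere (0::'a) 1" f] by auto
  show ?thesis
  proof
    show "norm u = 1" using u(1) by simp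
    show "(\<Sum>i\<in>I. (u \<bullet> v i)\<^sup>2) = f u" by (simp add: f_def)
    fix w :: 'a
    show "(\<Sum>i\<in>I. (w \<bullet> v i)\<^sup>2) \<le> f u * (w \<bullet> w)"
    proof (cases "w = 0")
      case False
      have "f (w /\<^sub>R norm w) \<le> f u" using False by (intro u(2)) simp
      also have "f (w /\<^sub>R norm w) = f w / (norm w)\<^sup>2"
        by (simp add: f_def power_mult_distrib sum_divide_distrib field_simps power_divide)
      finally show ?thesis
        using False by (simp add: f_def dot_square_norm field_simps)
    qed simp
  qed
qed

lemma orthonormal_parseval:
  fixes B :: "'a::euclidean_space set"
  assumes "pairwise orthogonal B" "\<And>e. e \<in> B \<Longrightarrow> norm e = 1" "x \<in> span B" "finite B"
  shows "(\<Sum>e\<in>B. (x \<bullet> e) * (e \<bullet> z)) = x \<bullet> z"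
  using arg_cong[OF orthonormal_basis_expand[OF assms], of "\<lambda>w. w \<bullet> z"]
  by (simp add: inner_sum_left)

section \<open>Spectral inequalities\<close>

text \<open>Vectors are indexed, so that one can be replaced by its negative without touching
  \<open>I\<close>. Writing the angle as \<open>1 / (2 * l + 1)\<close> makes \<open>l\<close> the
  shift in \<open>l I + J / 2 - A\<close>.\<close>

locale equiangular_family =
  fixes I :: "'i set" and v :: "'i \<Rightarrow> real ^ 'r" and l :: real
  assumes fin: "finite I" and l_pos: "l > 0"
    and unit: "\<And>i. i \<in> I \<Longrightarrow> v i \<bullet> v i = 1"
    and angle: "\<And>i j. \<lbrakk>i \<in> I; j \<in> I; i \<noteq> j\<rbrakk> \<Longrightarrow> \<bar>v i \<bullet> v j\<bar> = 1 / (2 * l + 1)"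
begin

definition n :: real where "n = card I"
text \<open>With \<open>\<alpha> = 1 / (2 l + 1)\<close> one has \<open>2 b = 1 / \<alpha>\<^sup>2 - 1\<close>, so the binomial coefficient of the
  theorem is \<open>b (2 b - 1)\<close>, and \<open>D = v\<^sub>j\<^sup>T K v\<^sub>j\<close> for every \<open>j\<close>, where \<open>K = \<Sum> v\<^sub>i v\<^sub>i\<^sup>T\<close>.\<close>

definition b :: real where "b = 2 * l * (l + 1)"
definition D :: real where "D = (n + 2 * b) / (2 * l + 1)\<^sup>2"

lemma b_pos: "b > 0"
  using l_pos by (simp add: b_def)

lemma n_nonneg: "n \<ge> 0"
  by (simp add: n_def)

lemma D_pos: "D > 0"
  using l_pos b_pos n_nonneg by (simp add: D_def)

lemma inner_squared:
  "\<lbrakk>i \<in> I; j \<in> I\<rbrakk> \<Longrightarrow> (v i \<bullet> v j)\<^sup>2 = (if i = j then 1 else 1 / (2 * l + 1)\<^sup>2)"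
proof (cases "i = j")
  case False
  assume "i \<in> I" "j \<in> I"
  with angle False have "\<bar>v i \<bullet> v j\<bar>\<^sup>2 = (1 / (2 * l + 1))\<^sup>2" by metis
  with False show ?thesis by (simp add: power_divide)
qed (simp add: unit)

lemma weighted_row:
  assumes "j \<in> I"
  shows "(\<Sum>i\<in>I. (v j \<bullet> v i)\<^sup>2 * w i) = (sum w I + 2 * b * w j) / (2 * l + 1)\<^sup>2"
proof -
  have "(\<Sum>i\<in>I. (v j \<bullet> v i)\<^sup>2 * w i)
      = (\<Sum>i\<in>I. w i / (2 * l + 1)\<^sup>2 + (if j = i then w j * (1 - 1 / (2 * l + 1)\<^sup>2) else 0))"
    using assms by (intro sum.cong refl) (auto simp: inner_squared algebra_simps)
  also have "\<dots> = sum w I / (2 * l + 1)\<^sup>2 + w j * (1 - 1 / (2 * l + 1)\<^sup>2)"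
    using assms fin by (simp add: sum.distrib sum_divide_distrib)
  also have "1 - 1 / (2 * l + 1)\<^sup>2 = 2 * b / (2 * l + 1)\<^sup>2"
    using l_pos by (simp add: b_def divide_simps) (simp add: power2_eq_square algebra_simps)
  finally show ?thesis
    by (simp add: add_divide_distrib mult_ac)
qed

lemma row_energy: "j \<in> I \<Longrightarrow> (\<Sum>i\<in>I. (v j \<bullet> v i)\<^sup>2) = D"
  using weighted_row[of j "\<lambda>_. 1"] by (simp add: n_def D_def)

text \<open>The projection of \<open>v\<^sub>j u\<^sup>T + u v\<^sub>j\<^sup>T\<close> onto the span of the matrices \<open>v\<^sub>i v\<^sub>i\<^sup>T\<close> does not
  increase the Frobenius norm.\<close>

lemma eigenvector_coordinate:
  assumes u: "u \<bullet> u = 1" and eig: "(\<Sum>i\<in>I. (u \<bullet> v i) *\<^sub>R v i) = y *\<^sub>R u" and j: "j \<in> I"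
  shows "y * (1 - y * (u \<bullet> v j)\<^sup>2 / D) \<le> b * (1 - (u \<bullet> v j)\<^sup>2)"
proof -
  define a where "a = 1 / (2 * l + 1)\<^sup>2"
  define t where "t = (u \<bullet> v j)\<^sup>2"
  define X where "X = outer (v j) u + outer u (v j)"
  have a: "a > 0" "2 * b * a = 1 - a"
    using l_pos by (auto simp: a_def b_def divide_simps) (simp add: power2_eq_square algebra_simps)
  have D: "(1 - a) + n * a = D"
    unfolding a(2)[symmetric] by (simp add: D_def a_def add_divide_distrib)
  have form_u: "(\<Sum>i\<in>I. (u \<bullet> v i)\<^sup>2) = y"
    using arg_cong[OF eig, of "(\<bullet>) u"] u by (simp add: inner_sum_right power2_eq_square)
  have row_u: "(\<Sum>i\<in>I. (v j \<bullet> v i) * (u \<bullet> v i)) = y * (u \<bullet> v j)"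
    using arg_cong[OF eig, of "(\<bullet>) (v j)"]
    by (simp add: inner_sum_right mult.commute inner_commute[of "v j" u])
  have XW: "X \<bullet> outer (v i) (v i) = 2 * ((v j \<bullet> v i) * (u \<bullet> v i))" for i
    by (simp add: X_def inner_add_left inner_outer)
  have "(\<Sum>i\<in>I. (X \<bullet> outer (v i) (v i))\<^sup>2) - a / ((1 - a) + card I * a)
      * (\<Sum>i\<in>I. X \<bullet> outer (v i) (v i))\<^sup>2 \<le> (1 - a) * (X \<bullet> X)"
  proof (rule gram_projection)
    show "1 - a > 0" "a \<ge> 0" "finite I"
      using a b_pos fin by (simp_all flip: a(2))
  next
    fix i k assume "i \<in> I" "k \<in> I"
    then show "outer (v i) (v i) \<bullet> outer (v k) (v k) = (if i = k then 1 - a + a else a)"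
      using inner_squared[of i k] by (simp add: inner_outer a_def power2_eq_square)
  qed
  moreover have "(\<Sum>i\<in>I. (X \<bullet> outer (v i) (v i))\<^sup>2) = 4 * (a * y + (1 - a) * t)"
  proof -
    have "(\<Sum>i\<in>I. (X \<bullet> outer (v i) (v i))\<^sup>2) = 4 * (\<Sum>i\<in>I. (v j \<bullet> v i)\<^sup>2 * (u \<bullet> v i)\<^sup>2)"
      by (simp add: XW power_mult_distrib sum_distrib_left)
    then show ?thesis
      unfolding weighted_row[OF j] form_u a(2)[symmetric] by (simp add: a_def t_def add_divide_distrib)
  qed
  moreover have "(\<Sum>i\<in>I. X \<bullet> outer (v i) (v i))\<^sup>2 = 4 * (y\<^sup>2 * t)"
    by (simp add: XW row_u power_mult_distrib t_def flip: sum_distrib_left)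
  moreover have "X \<bullet> X = 2 * (1 + t)"
    using u unit[OF j]
    by (simp add: X_def inner_add inner_outer t_def power2_eq_square inner_commute)
  ultimately have "4 * (a * y + (1 - a) * t) - a / D * (4 * (y\<^sup>2 * t)) \<le> (1 - a) * (2 * (1 + t))"
    unfolding D[unfolded n_def] by simp
  moreover have "y * (1 - y * t / D) = y - y\<^sup>2 * t / D"
    "a / D * (4 * (y\<^sup>2 * t)) = 4 * (a * (y\<^sup>2 * t / D))"
    by (simp_all add: algebra_simps power2_eq_square)
  moreover have "2 * a * (y - z) \<le> (1 - a) * (1 - t)"
    if "4 * (a * y + (1 - a) * t) - 4 * (a * z) \<le> (1 - a) * (2 * (1 + t))" for z
    using that by (simp add: algebra_simps)
  ultimately have "2 * a * (y * (1 - y * t / D)) \<le> (1 - a) * (1 - t)"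
    by metis
  then have "2 * a * (y * (1 - y * t / D)) \<le> 2 * a * (b * (1 - t))"
    unfolding a(2)[symmetric] by (simp only: mult_ac)
  then show ?thesis
    using a by (simp add: t_def)
qed

lemma form_value:
  assumes "u \<bullet> u = 1" "(\<Sum>i\<in>I. (u \<bullet> v i) *\<^sub>R v i) = y *\<^sub>R u"
  shows "(\<Sum>i\<in>I. (u \<bullet> v i)\<^sup>2) = y"
  using arg_cong[OF assms(2), of "(\<bullet>) u"] assms(1)
  by (simp add: inner_sum_right power2_eq_square)

text \<open>\<open>eigenvector_coordinate\<close> summed over \<open>I\<close>, where the squared
  coordinates of \<open>u\<close> add up to \<open>y\<close>.\<close>

lemma eigenvalue_cubic:
  assumes u: "u \<bullet> u = 1" and eig: "(\<Sum>i\<in>I. (u \<bullet> v i) *\<^sub>R v i) = y *\<^sub>R u"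
  shows "n * D * y - y ^ 3 \<le> b * D * (n - y)"
proof -
  have "(\<Sum>j\<in>I. y * (1 - y * (u \<bullet> v j)\<^sup>2 / D)) \<le> (\<Sum>j\<in>I. b * (1 - (u \<bullet> v j)\<^sup>2))"
    by (intro sum_mono eigenvector_coordinate u eig)
  then have "y * (n - y * y / D) \<le> b * (n - y)"
    using form_value[OF u eig]
    by (simp add: sum_subtractf n_def flip: sum_distrib_left sum_divide_distrib)
  then have "y * (n - y * y / D) * D \<le> b * (n - y) * D"
    using D_pos by (intro mult_right_mono) auto
  then show ?thesis
    using D_pos by (simp add: algebra_simps power3_eq_cube)
qed

text \<open>Pairing the eigenvector equation with \<open>v j\<close> writes
  \<open>y * (u \<bullet> v j)\<close> as a sum to which Cauchy-Schwarz applies; the squares of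
  these numbers add up to \<open>y ^ 3\<close>.\<close>

lemma eigenvalue_squared_le:
  assumes u: "u \<bullet> u = 1" and eig: "(\<Sum>i\<in>I. (u \<bullet> v i) *\<^sub>R v i) = y *\<^sub>R u" and y: "y > 0"
  shows "y\<^sup>2 \<le> n * D"
proof -
  have "y\<^sup>2 * y = (\<Sum>j\<in>I. (y * (u \<bullet> v j))\<^sup>2)"
    by (simp add: power_mult_distrib form_value[OF u eig] flip: sum_distrib_left)
  also have "\<dots> = (\<Sum>j\<in>I. (\<Sum>i\<in>I. (u \<bullet> v i) * (v j \<bullet> v i))\<^sup>2)"
    using arg_cong[OF eig, of "(\<bullet>) (v j)" for j]
    by (simp add: inner_sum_right inner_commute[of _ u])
  also have "\<dots> \<le> (\<Sum>j\<in>I. y * D)"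
  proof (intro sum_mono)
    fix j assume "j \<in> I"
    then show "(\<Sum>i\<in>I. (u \<bullet> v i) * (v j \<bullet> v i))\<^sup>2 \<le> y * D"
      using Cauchy_Schwarz_ineq_sum[of "\<lambda>i. u \<bullet> v i" "\<lambda>i. v j \<bullet> v i" I]
      by (simp add: form_value[OF u eig] row_energy)
  qed
  finally have "y\<^sup>2 * y \<le> n * D * y" by (simp add: n_def mult_ac)
  then show ?thesis using y by simp
qed

lemma form_max_ge:
  assumes bound: "\<And>w. (\<Sum>i\<in>I. (w \<bullet> v i)\<^sup>2) \<le> y * (w \<bullet> w)" and "I \<noteq> {}"
  shows "y \<ge> D"
proof -
  obtain j where "j \<in> I" using \<open>I \<noteq> {}\<close> by blast
  then show ?thesis using bound[of "v j"] by (simp add: row_energy unit)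
qed

text \<open>If the maximum of the form is \<open>D\<close>, every \<open>v j\<close> attains it and
  is an eigenvector. Then \<open>K\<close> acts as \<open>D\<close> on the whole span, and its trace
  \<open>n\<close> is \<open>D\<close> times the dimension.\<close>

lemma tight_case:
  assumes bound: "\<And>w. (\<Sum>i\<in>I. (w \<bullet> v i)\<^sup>2) \<le> D * (w \<bullet> w)"
  shows "D * dim (span (v ` I)) = n"
proof -
  obtain B where B: "B \<subseteq> span (v ` I)" "pairwise orthogonal B" "\<And>e. e \<in> B \<Longrightarrow> norm e = 1"
    "independent B" "card B = dim (span (v ` I))" "span B = span (v ` I)"
    using orthonormal_basis_subspace[of "span (v ` I)"] by auto
  have finB: "finite B" using B(4) by (rule independent_imp_finite)
  have eig: "(\<Sum>i\<in>I. (w \<bullet> v i) *\<^sub>R v i) = D *\<^sub>R w" if "w \<in> span (v ` I)" for w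
    using that
  proof (induction rule: span_induct_alt)
    case (step c x w)
    then obtain j where j: "j \<in> I" "x = v j" by blast
    have "(\<Sum>i\<in>I. (x \<bullet> v i) *\<^sub>R v i) = D *\<^sub>R x"
      using row_energy j unit by (intro maximizer_is_eigenvector bound) simp
    moreover have "(\<Sum>i\<in>I. ((c *\<^sub>R x + w) \<bullet> v i) *\<^sub>R v i)
        = c *\<^sub>R (\<Sum>i\<in>I. (x \<bullet> v i) *\<^sub>R v i) + (\<Sum>i\<in>I. (w \<bullet> v i) *\<^sub>R v i)"
      by (simp add: inner_add_left scaleR_add_left sum.distrib scaleR_sum_right)
    ultimately show ?case
      using step by (simp add: scaleR_add_right)
  qed simp
  have "D * card B = (\<Sum>e\<in>B. e \<bullet> (D *\<^sub>R e))"
    using B(3) by (simp add: dot_square_norm)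
  also have "\<dots> = (\<Sum>e\<in>B. \<Sum>i\<in>I. (e \<bullet> v i)\<^sup>2)"
  proof (intro sum.cong refl)
    fix e assume "e \<in> B"
    then have "e \<bullet> (D *\<^sub>R e) = e \<bullet> (\<Sum>i\<in>I. (e \<bullet> v i) *\<^sub>R v i)"
      using eig[of e] B(1) by auto
    then show "e \<bullet> (D *\<^sub>R e) = (\<Sum>i\<in>I. (e \<bullet> v i)\<^sup>2)"
      by (simp only: inner_sum_right inner_scaleR_right power2_eq_square)
  qed
  also have "\<dots> = (\<Sum>i\<in>I. \<Sum>e\<in>B. (v i \<bullet> e) * (e \<bullet> v i))"
    by (subst sum.swap) (simp add: power2_eq_square inner_commute)
  also have "\<dots> = n"
    using orthonormal_parseval[OF B(2,3) _ finB] B(6) by (simp add: n_def unit span_base)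
  finally show ?thesis using B(5) by simp
qed

text \<open>Cauchy--Schwarz for the Frobenius product of \<open>K - q u u\<^sup>T\<close>, where \<open>K = \<Sum> v\<^sub>i v\<^sub>i\<^sup>T\<close>, with the
  orthogonal projection onto the complement of \<open>u\<close> in the span of the family.\<close>

lemma rank_bound:
  assumes u: "u \<bullet> u = 1" "u \<in> span (v ` I)" and q: "q = (\<Sum>i\<in>I. (u \<bullet> v i)\<^sup>2)"
  shows "(n - q)\<^sup>2 \<le> (real (dim (span (v ` I))) - 1) * (n * D - q\<^sup>2)" and "0 \<le> n * D - q\<^sup>2"
proof -
  obtain B where B: "B \<subseteq> span (v ` I)" "pairwise orthogonal B" "\<And>e. e \<in> B \<Longrightarrow> norm e = 1"
    "independent B" "card B = dim (span (v ` I))" "span B = span (v ` I)"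
    using orthonormal_basis_subspace[of "span (v ` I)"] by auto
  have finB: "finite B" using B(4) by (rule independent_imp_finite)
  have parseval: "(\<Sum>e\<in>B. (e \<bullet> x)\<^sup>2) = x \<bullet> x" if "x \<in> span (v ` I)" for x
    using orthonormal_parseval[OF B(2,3) _ finB, of x x] that B(6)
    by (simp add: power2_eq_square inner_commute)
  define P where "P = (\<Sum>e\<in>B. outer e e)"
  define K where "K = (\<Sum>i\<in>I. outer (v i) (v i))"
  define U where "U = outer u u"
  have "P \<bullet> P = (\<Sum>e\<in>B. \<Sum>f\<in>B. (e \<bullet> f)\<^sup>2)"
    by (simp add: P_def inner_sum_left inner_sum_right inner_outer power2_eq_square inner_commute)
  also have "\<dots> = card B"
    using B(1,3) by (subst sum.swap) (simp add: parseval subset_iff dot_square_norm)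
  finally have PP: "P \<bullet> P = card B" .
  have PU: "P \<bullet> U = 1"
    using parseval[OF u(2)] u(1)
    by (simp add: P_def U_def inner_sum_left inner_outer power2_eq_square)
  have KP: "K \<bullet> P = n"
  proof -
    have "K \<bullet> P = (\<Sum>i\<in>I. \<Sum>e\<in>B. (e \<bullet> v i)\<^sup>2)"
      by (simp add: K_def P_def inner_sum_left inner_sum_right[of _ _ B] inner_outer
          inner_commute[of "v _"] power2_eq_square) (rule sum.swap)
    then show ?thesis
      by (simp add: parseval span_base unit n_def)
  qed
  have KU: "K \<bullet> U = q"
    by (simp add: K_def U_def q inner_sum_left inner_outer power2_eq_square inner_commute[of u])
  have KK: "K \<bullet> K = n * D"
  proof -
    have "K \<bullet> K = (\<Sum>i\<in>I. \<Sum>j\<in>I. (v i \<bullet> v j)\<^sup>2)"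
      unfolding K_def inner_sum_left inner_sum_right
      by (subst sum.swap) (simp add: inner_outer power2_eq_square)
    then show ?thesis by (simp add: row_energy n_def)
  qed
  have UU: "U \<bullet> U = 1"
    using u by (simp add: U_def inner_outer)
  have "((K - q *\<^sub>R U) \<bullet> (P - U))\<^sup>2 \<le> ((K - q *\<^sub>R U) \<bullet> (K - q *\<^sub>R U)) * ((P - U) \<bullet> (P - U))"
    by (rule Cauchy_Schwarz_ineq)
  moreover have "(K - q *\<^sub>R U) \<bullet> (P - U) = n - q"
    by (simp add: inner_diff KP KU UU PU inner_commute[of U P])
  moreover have "(K - q *\<^sub>R U) \<bullet> (K - q *\<^sub>R U) = n * D - q\<^sup>2"
    by (simp add: inner_diff KK KU UU inner_commute[of U K] power2_eq_square)
  moreover have "(P - U) \<bullet> (P - U) = real (dim (span (v ` I))) - 1"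
    by (simp add: inner_diff PP PU UU inner_commute[of U P] B(5))
  moreover have "0 \<le> (K - q *\<^sub>R U) \<bullet> (K - q *\<^sub>R U)" by simp
  ultimately show "(n - q)\<^sup>2 \<le> (real (dim (span (v ` I))) - 1) * (n * D - q\<^sup>2)"
    and "0 \<le> n * D - q\<^sup>2" by (simp_all add: mult.commute)
qed

end

section \<open>Real inequalities\<close>

text \<open>Here \<open>w = n / b\<close>, and the test point for the cubic of
  \<open>cubic_root_bound\<close> is \<open>b (w - (l - 1/2)) / (2 l + 1)\<close>. It is chosen so that for \<open>l = 1\<close> the
  resulting degree bound \<open>l\<^sup>3 + l\<^sup>2 / 2 + l / 2\<close> is exactly \<open>2\<close>.\<close>

lemma cubic_test_point_negative:
  fixes l w :: real
  assumes l: "l \<ge> 1/2" and w: "w \<ge> 4 * l\<^sup>2 + 4 * l - 1" "l > 1/2 \<or> w > 4 * l\<^sup>2 + 4 * l - 1"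
  shows "(w - (l - 1/2)) ^ 3 - (w + 1) * (w + 2) * (w - (l - 1/2)) + w * (2 * l + 1) * (w + 2) < 0"
proof -
  \<comment> \<open>\<open>m\<close> is the excess of \<open>w\<close> over its least admissible
    value. In \<open>p\<close> and \<open>m\<close> the negated expression has only nonnegative
    coefficients.\<close>
  define p m where "p = l - 1/2" and "m = w - (4 * p\<^sup>2 + 8 * p + 2)"
  have lw: "l = p + 1/2" "w = 4 * p\<^sup>2 + 8 * p + 2 + m"
    by (simp_all add: p_def m_def)
  have pm: "p \<ge> 0" "m \<ge> 0" "p > 0 \<or> m > 0"
    using assms unfolding lw by (auto simp: power2_eq_square algebra_simps)
  have "0 < 10 * p\<^sup>2 + 2 * m"
    using pm by (auto intro: add_nonneg_pos add_pos_nonneg)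
  also have "\<dots> \<le> 10 * p\<^sup>2 + 13 * p ^ 3 + 4 * p ^ 4 + 5 * p\<^sup>2 * m + 9 * p * m + 2 * m + m\<^sup>2"
    using pm by simp
  also have "\<dots> = - ((w - (l - 1/2)) ^ 3 - (w + 1) * (w + 2) * (w - (l - 1/2))
      + w * (2 * l + 1) * (w + 2))"
    unfolding lw by (simp add: power2_eq_square power3_eq_cube power4_eq_xxxx algebra_simps)
  finally show ?thesis by simp
qed

text \<open>The inequality of \<open>degree_cubic_scaled\<close> in the normalised variable
  \<open>g\<close> with \<open>y = b * (w - g) / (2 * l + 1)\<close>. It holds at both ends of the
  range of \<open>g\<close>, and the interpolation remainder is small enough in between.\<close>

lemma degree_cubic_pos:
  fixes l w g :: real
  assumes l: "l \<ge> 1/2" and w: "w \<ge> 4 * l\<^sup>2 + 4 * l - 1" "l > 1/2 \<or> w > 4 * l\<^sup>2 + 4 * l - 1"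
    and g: "-1 < g" "g < l - 1/2"
  shows "(w - g) ^ 3 < (w + 2) * (w - g - (2 * l + 1)) * (w - 2 * g + 2 * l - 1) + (w + 2) * (w - g)"
proof -
  define p m r where "p = l - 1/2" and "m = w - (4 * p\<^sup>2 + 8 * p + 2)" and "r = g + 1"
  have lw: "l = p + 1/2" "w = 4 * p\<^sup>2 + 8 * p + 2 + m" "g = r - 1"
    by (simp_all add: p_def m_def r_def)
  have pm: "p \<ge> 0" "m \<ge> 0" "r > 0" "r < 1 + p"
    using assms unfolding lw by (auto simp: power2_eq_square algebra_simps)
  \<comment> \<open>\<open>E1\<close> and \<open>E2\<close> are the values of right side minus left
    side at \<open>g = -1\<close> and \<open>g = l - 1/2\<close>; \<open>f\<close> is the linear
    factor in the remainder of linear interpolation between them.\<close>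
  define E1 where "E1 = (1 + 2 * p) * (4 * p\<^sup>2 + 6 * p + 1) + m * (4 * p\<^sup>2 + 10 * p + 4) + m\<^sup>2"
  define E2 where "E2 = - ((w - (l - 1/2)) ^ 3 - (w + 1) * (w + 2) * (w - (l - 1/2))
      + w * (2 * l + 1) * (w + 2))"
  define f where "f = r - 7 * p - 4 * p\<^sup>2 - m"
  have E2: "E2 > 0"
    using cubic_test_point_negative[OF l w] by (simp add: E2_def)
  have "1 \<le> (1 + 2 * p) * (4 * p\<^sup>2 + 6 * p + 1)"
    using pm by (simp add: algebra_simps)
  then have E1: "E1 \<ge> 1"
    using pm by (simp add: E1_def add_increasing2)
  have "(1 + p) * r * f \<le> 1"
  proof (cases "f \<ge> 0")
    case True
    have f: "f \<le> 1 - 6 * p"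
      using pm by (simp add: f_def) (smt (verit) zero_le_power2)
    have "(1 + p) * r * f \<le> (1 + p) * (1 + p) * (1 - 6 * p)"
      using pm f True by (intro mult_mono mult_nonneg_nonneg) auto
    also have "\<dots> = 1 - (4 * p + 11 * p\<^sup>2 + 6 * p ^ 3)"
      by (simp add: algebra_simps power2_eq_square power3_eq_cube)
    also have "\<dots> \<le> 1"
      using pm zero_le_power[of p 2] zero_le_power[of p 3] by linarith
    finally show ?thesis .
  next
    case False
    then have "(1 + p) * r * f \<le> 0"
      using pm by (intro mult_nonneg_nonpos) auto
    then show ?thesis by simp
  qed
  then have "0 \<le> (1 + p - r) * (E1 - (1 + p) * r * f)"
    using E1 pm by (intro mult_nonneg_nonneg) auto
  then have "0 < (1 + p - r) * (E1 - (1 + p) * r * f) + r * E2"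
    using pm E2 by (intro add_nonneg_pos mult_pos_pos) auto
  also have "\<dots> = (1 + p) * ((w + 2) * (w - g - (2 * l + 1)) * (w - 2 * g + 2 * l - 1)
      + (w + 2) * (w - g) - (w - g) ^ 3)"
    unfolding E1_def E2_def f_def unfolding lw
    by (simp add: power2_eq_square power3_eq_cube algebra_simps)
  finally show ?thesis
    using pm by (simp add: zero_less_mult_iff)
qed

text \<open>The cubic \<open>f\<close> is nonpositive at \<open>D\<close>, negative at the test
  point \<open>z\<close> and convex in between, so \<open>y > D\<close> with
  \<open>f y \<ge> 0\<close> has to lie beyond \<open>z\<close>.\<close>

lemma cubic_root_bound:
  fixes l w y b D :: real
  assumes l: "l \<ge> 1/2" and w: "w \<ge> 4 * l\<^sup>2 + 4 * l - 1" "l > 1/2 \<or> w > 4 * l\<^sup>2 + 4 * l - 1"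
    and b: "b = 2 * l * (l + 1)" and D: "D = b * (w + 2) / (2 * l + 1)\<^sup>2" and y: "y > D"
    and cubic: "b * w * D * y - y ^ 3 \<le> b * D * (b * w - y)"
  shows "b * (w - (l - 1/2)) < (2 * l + 1) * y"
proof (rule ccontr)
  define s where "s = 2 * l + 1"
  define z where "z = b * (w - (l - 1/2)) / s"
  define f where "f x = x ^ 3 - (b * w + b) * D * x + b * w * b * D" for x
  assume "\<not> b * (w - (l - 1/2)) < (2 * l + 1) * y"
  then have yz: "y \<le> z" using l by (simp add: z_def s_def field_simps)
  have s: "s > 0" "s\<^sup>2 = 2 * b + 1"
    using l by (simp_all add: s_def b power2_eq_square algebra_simps)
  have b_pos: "b > 0" using l by (simp add: b)
  have w': "w \<ge> 2 * b - 1" using w(1) by (simp add: b power2_eq_square algebra_simps)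
  have b1: "b \<ge> 3/2"
  proof -
    have "1/2 * (3/2) \<le> l * (l + 1)" using l by (intro mult_mono) auto
    then show ?thesis by (simp add: b)
  qed
  have "b * s\<^sup>2 \<le> b * (w + 2)"
    using w' b_pos s(2) by (intro mult_left_mono) auto
  moreover have D': "D = b * (w + 2) / s\<^sup>2" by (simp add: D s_def)
  ultimately have bD: "b \<le> D" using s(1) by (simp add: le_divide_eq)
  have "w + 2 \<le> w * s\<^sup>2"
  proof -
    have "2 * 3 \<le> w * (2 * b)" using w' b1 by (intro mult_mono) auto
    then show ?thesis by (simp add: s(2) algebra_simps)
  qed
  then have "b * (w + 2) \<le> b * (w * s\<^sup>2)" using b_pos by (intro mult_left_mono) auto
  then have Dn: "D \<le> b * w" using s(1) by (simp add: D' divide_le_eq mult_ac)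
  have "f D = D * ((D - b * w) * (D - b))"
    by (simp add: f_def power3_eq_cube algebra_simps)
  also have "\<dots> \<le> 0"
    using Dn bD b_pos by (intro mult_nonneg_nonpos mult_nonpos_nonneg) auto
  finally have fD: "f D \<le> 0" .
  have "f z = b ^ 3 / s ^ 3 * ((w - (l - 1/2)) ^ 3 - (w + 1) * (w + 2) * (w - (l - 1/2))
      + w * (2 * l + 1) * (w + 2))"
  proof -
    have "f z = (b * (w - (l - 1/2)) / s) ^ 3 - (b * w + b) * (b * (w + 2) / s\<^sup>2) * (b * (w - (l - 1/2)) / s)
        + b * w * b * (b * (w + 2) / s\<^sup>2)"
      by (simp add: f_def z_def D s_def)
    also have "\<dots> = b ^ 3 / s ^ 3 * ((w - (l - 1/2)) ^ 3 - (w + 1) * (w + 2) * (w - (l - 1/2)) + w * s * (w + 2))"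
    proof -
      have "(b * g / s) ^ 3 - (b * w + b) * (b * (w + 2) / s\<^sup>2) * (b * g / s)
        + b * w * b * (b * (w + 2) / s\<^sup>2) = b ^ 3 / s ^ 3 * (g ^ 3 - (w + 1) * (w + 2) * g + w * s * (w + 2))" for g
        using s(1) by (simp add: field_simps power2_eq_square power3_eq_cube)
      then show ?thesis .
    qed
    finally show ?thesis by (simp add: s_def)
  qed
  also have "\<dots> < 0"
    using cubic_test_point_negative[OF l w] b_pos s(1) by (intro mult_pos_neg) auto
  finally have fz: "f z < 0" .
  have fy: "0 \<le> f y" using cubic by (simp add: f_def algebra_simps)
  \<comment> \<open>Linear interpolation at \<open>D\<close> and \<open>z\<close>:
    \<open>y + D + z\<close> is the second divided difference of \<open>f\<close>, and its sign
    expresses convexity.\<close>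
  have "f y * (z - D) = f D * (z - y) + f z * (y - D) - (y - D) * (z - y) * (y + D + z) * (z - D)"
    by (simp add: f_def power3_eq_cube algebra_simps)
  moreover have "f D * (z - y) \<le> 0" "f z * (y - D) < 0"
    using fD fz yz y by (auto intro: mult_nonpos_nonneg mult_neg_pos)
  moreover have "0 \<le> (y - D) * (z - y) * (y + D + z) * (z - D)"
    using yz y bD b_pos by (intro mult_nonneg_nonneg) auto
  moreover have "0 \<le> f y * (z - D)"
    using fy yz y by (intro mult_nonneg_nonneg) auto
  ultimately show False by linarith
qed

text \<open>\<open>cubic_root_bound\<close> and the trace bound \<open>square\<close> confine
  \<open>g\<close> to the interval of \<open>degree_cubic_pos\<close>; the rest is multiplication by
  \<open>b ^ 3 / s ^ 3\<close>. The last factor is shaped for the estimate in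
  \<open>degree_less\<close>.\<close>

lemma degree_cubic_scaled:
  fixes l w y b D :: real
  assumes l: "l \<ge> 1/2" and w: "w \<ge> 4 * l\<^sup>2 + 4 * l - 1" "l > 1/2 \<or> w > 4 * l\<^sup>2 + 4 * l - 1"
    and b: "b = 2 * l * (l + 1)" and D: "D = b * (w + 2) / (2 * l + 1)\<^sup>2" and y: "y > D" "y > 0"
    and cubic: "b * w * D * y - y ^ 3 \<le> b * D * (b * w - y)"
    and square: "y\<^sup>2 \<le> b * w * D"
  shows "y * (y\<^sup>2 - b * D) < D * (y - b) * (2 * (2 * l + 1) * y - b * w + 2 * (b * (l - 1/2)))"
proof -
  define s where "s = 2 * l + 1"
  define g where "g = w - s * y / b"
  have s: "s > 0" using l by (simp add: s_def)
  have b_pos: "b > 0" using l by (simp add: b)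
  have D': "D = b * (w + 2) / s\<^sup>2" by (simp add: D s_def)
  have y_eq: "y = b * (w - g) / s" using s b_pos by (simp add: g_def field_simps)
  have "b * (w - (l - 1/2)) < s * y"
    using cubic_root_bound[OF l w b D y(1) cubic] by (simp add: s_def)
  then have g_less: "g < l - 1/2" using b_pos by (simp add: g_def field_simps)
  have "(s * y)\<^sup>2 = s\<^sup>2 * y\<^sup>2" by (simp add: power_mult_distrib)
  also have "\<dots> \<le> s\<^sup>2 * (b * w * D)" using square by (intro mult_left_mono) auto
  also have "\<dots> = b\<^sup>2 * (w * (w + 2))"
    using s by (simp add: D' power2_eq_square)
  also have "\<dots> < b\<^sup>2 * (w + 1)\<^sup>2"
    using b_pos by (intro mult_strict_left_mono) (auto simp: power2_eq_square algebra_simps)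
  finally have "(s * y)\<^sup>2 < (b * (w + 1))\<^sup>2" by (simp add: power_mult_distrib)
  moreover have "0 \<le> b * (w + 1)"
  proof -
    have "0 \<le> 4 * l\<^sup>2 + 4 * l" using l by simp
    then show ?thesis using w(1) b_pos by simp
  qed
  ultimately have "s * y < b * (w + 1)"
    by (meson power_less_imp_less_base)
  then have g_greater: "-1 < g" using b_pos by (simp add: g_def field_simps)
  have "0 < b ^ 3 / s ^ 3 * ((w + 2) * (w - g - s) * (w - 2 * g + 2 * l - 1) + (w + 2) * (w - g) - (w - g) ^ 3)"
    using degree_cubic_pos[OF l w g_greater g_less] b_pos s by (simp add: s_def)
  also have "\<dots> = (b * (w + 2) / s\<^sup>2) * (b * (w - g) / s - b) * (2 * s * (b * (w - g) / s) - b * w + 2 * (b * (l - 1/2)))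
      - (b * (w - g) / s) * ((b * (w - g) / s)\<^sup>2 - b * (b * (w + 2) / s\<^sup>2))"
  proof -
    have "2 * s * (b * (w - g) / s) - b * w + 2 * (b * (l - 1/2)) = b * (w - 2 * g + 2 * l - 1)"
      using s by (simp add: field_simps)
    moreover have "(b * (w + 2) / s\<^sup>2) * (b * h / s - b) * (b * k) - (b * h / s) * ((b * h / s)\<^sup>2 - b * (b * (w + 2) / s\<^sup>2))
        = b ^ 3 / s ^ 3 * ((w + 2) * (h - s) * k + (w + 2) * h - h ^ 3)" for h k
      using s by (simp add: field_simps power2_eq_square power3_eq_cube)
    ultimately show ?thesis by metis
  qed
  also have "\<dots> = D * (y - b) * (2 * s * y - b * w + 2 * (b * (l - 1/2))) - y * (y\<^sup>2 - b * D)"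
    unfolding y_eq[symmetric] D'[symmetric] by simp
  finally show ?thesis by (simp add: s_def)
qed

text \<open>\<open>star\<close> and the lower bound on \<open>N\<close> give
  \<open>f d \<ge> 0\<close> for a convex quadratic \<open>f\<close> that is negative at
  \<open>L\<close> and at \<open>B\<close>, so \<open>d\<close> cannot lie between them.
  \<open>B\<close> is the degree bound of \<open>degree_less\<close>.\<close>

lemma star_test_gap:
  fixes l N d :: real
  assumes l: "l \<ge> 1" and N: "N \<ge> 2 * l * (l + 1) * (4 * l\<^sup>2 + 4 * l - 1)"
    and d: "l\<^sup>2 < d" "d \<le> l ^ 3 + l\<^sup>2 / 2 + l / 2"
    and star: "N * l * (d - l\<^sup>2) \<le> d * (l + 1)\<^sup>2 * (2 * d - l\<^sup>2 - l)"
  shows "d \<le> l\<^sup>2 + l / 4"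
proof (rule ccontr)
  define L where "L = l\<^sup>2 + l / 4"
  define B where "B = l ^ 3 + l\<^sup>2 / 2 + l / 2"
  define f where "f x = (l + 1) * x * (2 * x - l\<^sup>2 - l) - 2 * l\<^sup>2 * (4 * l\<^sup>2 + 4 * l - 1) * (x - l\<^sup>2)"
    for x
  assume "\<not> d \<le> l\<^sup>2 + l / 4"
  then have dL: "L < d" "d \<le> B" using d by (simp_all add: L_def B_def)
  define x where "x = l - 1"
  have x: "l = 1 + x" "x \<ge> 0" using l by (simp_all add: x_def)
  have "f L = - (9/4 + 79/8 * x + 69/4 * x\<^sup>2 + 119/8 * x ^ 3 + 25/4 * x ^ 4 + x * x ^ 4)"
    unfolding f_def L_def x(1)
    by (simp add: field_simps power2_eq_square power3_eq_cube power4_eq_xxxx)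
  also have "\<dots> < 0"
  proof -
    have "0 \<le> 79/8 * x + 69/4 * x\<^sup>2 + 119/8 * x ^ 3 + 25/4 * x ^ 4 + x * x ^ 4"
      using x(2) by (intro add_nonneg_nonneg mult_nonneg_nonneg) auto
    then show ?thesis by linarith
  qed
  finally have fL: "f L < 0" .
  have "f B = - (2 * l ^ 3 * (3 * l ^ 4 + l ^ 3 / 2 - 2 * l\<^sup>2 + 2 * l - 1/2))"
    unfolding f_def B_def by (simp add: field_simps power2_eq_square power3_eq_cube power4_eq_xxxx)
  also have "\<dots> < 0"
  proof -
    have "l\<^sup>2 \<le> l ^ 4" using l by (intro power_increasing) auto
    then have "0 < 3 * l ^ 4 + l ^ 3 / 2 - 2 * l\<^sup>2 + 2 * l - 1/2"
      using l zero_le_power[of l 3] zero_le_power[of l 2] by linarith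
    then show ?thesis using l by simp
  qed
  finally have fB: "f B < 0" .
  have "(l + 1) * (2 * l\<^sup>2 * (4 * l\<^sup>2 + 4 * l - 1) * (d - l\<^sup>2))
      = 2 * l * (l + 1) * (4 * l\<^sup>2 + 4 * l - 1) * l * (d - l\<^sup>2)"
    by (simp add: power2_eq_square)
  also have "\<dots> \<le> N * l * (d - l\<^sup>2)"
    using N l d by (intro mult_right_mono) auto
  also have "\<dots> \<le> d * (l + 1)\<^sup>2 * (2 * d - l\<^sup>2 - l)"
    by (rule star)
  also have "\<dots> = (l + 1) * ((l + 1) * d * (2 * d - l\<^sup>2 - l))"
    by (simp add: power2_eq_square)
  finally have fd: "0 \<le> f d"
    using l by (simp add: f_def)
  have "f d * (B - L) = f L * (B - d) + f B * (d - L) - 2 * (l + 1) * (d - L) * (B - d) * (B - L)"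
    by (simp add: f_def algebra_simps)
  also have "\<dots> < 0"
  proof -
    have "f L * (B - d) \<le> 0" "f B * (d - L) < 0"
      using fL fB dL by (auto intro: mult_nonpos_nonneg mult_neg_pos)
    moreover have "0 \<le> 2 * (l + 1) * (d - L) * (B - d) * (B - L)"
      using dL l by (intro mult_nonneg_nonneg) auto
    ultimately show ?thesis by linarith
  qed
  finally show False
    using fd dL by (simp add: mult_less_0_iff)
qed

text \<open>Supplies the contradiction in \<open>sum_deg_le\<close>. The left side bounds the part
  of \<open>walk_test\<close> divided by the number of vertices, for degrees at most
  \<open>l\<^sup>2 + l / 4\<close>; the right side is what the other terms demand at average degree
  \<open>l\<^sup>2\<close>.\<close>

lemma walk_test_gap:
  fixes l N :: real
  assumes l: "l \<ge> 3/2" and N: "N \<ge> 2 * l * (l + 1) * (4 * l\<^sup>2 + 4 * l - 1)"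
  shows "(l + (l\<^sup>2 + l / 4) + (l\<^sup>2 + l / 4)\<^sup>2 / (2 * l\<^sup>2))\<^sup>2 / N * (2 * (l\<^sup>2 + l / 4) - l\<^sup>2 - l)
    < (1 / l\<^sup>2 - 1 / (4 * l ^ 3)) * (2 * l ^ 4 - l\<^sup>2) - l\<^sup>2"
proof -
  define s where "s = 3/2 * l\<^sup>2 + 3/2 * l + 1/32"
  define N0 where "N0 = 2 * l * (l + 1) * (4 * l\<^sup>2 + 4 * l - 1)"
  define x where "x = l - 3/2"
  have x: "l = 3/2 + x" "x \<ge> 0" using l by (simp_all add: x_def)
  have l2: "l\<^sup>2 \<ge> l" using l by (simp add: power2_eq_square)
  have N0: "N0 > 0" unfolding N0_def using l l2 by (intro mult_pos_pos) linarith+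
  have s: "l + (l\<^sup>2 + l / 4) + (l\<^sup>2 + l / 4)\<^sup>2 / (2 * l\<^sup>2) = s"
    using l by (simp add: s_def field_simps power2_eq_square)
  have "s\<^sup>2 / N * (2 * (l\<^sup>2 + l / 4) - l\<^sup>2 - l) \<le> s\<^sup>2 / N0 * (l\<^sup>2 - l / 2)"
  proof (intro mult_mono divide_left_mono)
    show "N0 \<le> N" "0 < N * N0" using N N0 by (auto simp: N0_def)
  qed (use N0 l l2 in auto)
  moreover have "s\<^sup>2 / N0 * (l\<^sup>2 - l / 2) < (4 * l ^ 3 - 2 * l\<^sup>2 - 4 * l + 1) / (4 * l)"
  proof -
    \<comment> \<open>In \<open>x = l - 3/2\<close> every coefficient is positive, which settles the
      sign on the whole range of \<open>l\<close>.\<close>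
    have "(4 * l ^ 3 - 2 * l\<^sup>2 - 4 * l + 1) * (l + 1) * (4 * l\<^sup>2 + 4 * l - 1) - 2 * l * s\<^sup>2 * (l - 1/2)
      = 45077/1024 + 458147/1024 * x + 522103/512 * x\<^sup>2 + 32237/32 * x ^ 3 + 7957/16 * x ^ 4
        + 483/4 * (x * x ^ 4) + 23/2 * (x\<^sup>2 * x ^ 4)"
      unfolding s_def x(1)
      by (simp add: field_simps power2_eq_square power3_eq_cube power4_eq_xxxx)
    moreover have "\<dots> > 0"
      using x(2) by (simp add: add_pos_nonneg)
    ultimately have "2 * l * s\<^sup>2 * (l - 1/2)
        < (4 * l ^ 3 - 2 * l\<^sup>2 - 4 * l + 1) * (l + 1) * (4 * l\<^sup>2 + 4 * l - 1)"
      by linarith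
    then have "(2 * l) * (2 * l * s\<^sup>2 * (l - 1/2))
        < (2 * l) * ((4 * l ^ 3 - 2 * l\<^sup>2 - 4 * l + 1) * (l + 1) * (4 * l\<^sup>2 + 4 * l - 1))"
      using l by (intro mult_strict_left_mono) auto
    then have "s\<^sup>2 * (l\<^sup>2 - l / 2) * (4 * l) < (4 * l ^ 3 - 2 * l\<^sup>2 - 4 * l + 1) * N0"
      unfolding N0_def by (simp add: algebra_simps power2_eq_square)
    then show ?thesis
      using N0 l by (simp add: divide_less_eq less_divide_eq)
  qed
  moreover have "(4 * l ^ 3 - 2 * l\<^sup>2 - 4 * l + 1) / (4 * l)
      = (1 / l\<^sup>2 - 1 / (4 * l ^ 3)) * (2 * l ^ 4 - l\<^sup>2) - l\<^sup>2"
    using l by (simp add: field_simps power2_eq_square power3_eq_cube power4_eq_xxxx)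
  ultimately show ?thesis unfolding s by linarith
qed

section \<open>The graph of negative inner products\<close>

locale psd_graph =
  fixes I :: "'i set" and A :: "'i \<Rightarrow> 'i \<Rightarrow> real" and l :: real
  assumes finite_vertices: "finite I" and nonempty: "I \<noteq> {}" and l_pos: "l > 0"
    and zero_one: "A i j = 0 \<or> A i j = 1"
    and sym: "A i j = A j i" and irrefl: "A i i = 0"
    and psd: "0 \<le> l * (\<Sum>i\<in>I. (z i)\<^sup>2) + (sum z I)\<^sup>2 / 2 - (\<Sum>i\<in>I. \<Sum>j\<in>I. z i * z j * A i j)"
begin

definition deg :: "'i \<Rightarrow> real" where "deg i = (\<Sum>j\<in>I. A i j)"

text \<open>The entries of \<open>A\<^sup>2\<close>, counting walks of length two.\<close>

definition codeg :: "'i \<Rightarrow> 'i \<Rightarrow> real" where "codeg i k = (\<Sum>j\<in>I. A i j * A j k)"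

lemma A_nonneg: "A i j \<ge> 0" and A_idem: "A i j * A i j = A i j"
  using zero_one[of i j] by auto

lemma deg_nonneg: "deg i \<ge> 0"
  by (simp add: deg_def A_nonneg sum_nonneg)

lemma codeg_nonneg: "codeg i k \<ge> 0"
  by (simp add: codeg_def A_nonneg sum_nonneg)

lemma codeg_sym: "codeg i k = codeg k i"
  by (simp add: codeg_def sym[of _ k] sym[of i] mult.commute)

lemma codeg_self: "codeg i i = deg i"
  by (simp add: codeg_def deg_def sym[of _ i] A_idem)

text \<open>Codegrees are natural numbers; this is how integrality enters the estimate of the
  average degree.\<close>

lemma codeg_squared_ge: "codeg i k \<le> (codeg i k)\<^sup>2"
proof -
  have "A i j * A j k = real (of_bool (A i j = 1 \<and> A j k = 1))" for j
    using zero_one[of i j] zero_one[of j k] by auto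
  then have "codeg i k = real (\<Sum>j\<in>I. of_bool (A i j = 1 \<and> A j k = 1))"
    unfolding codeg_def of_nat_sum by (intro sum.cong refl)
  then obtain c :: nat where "codeg i k = real c" ..
  then show ?thesis by (cases c) (auto simp: power2_eq_square)
qed

lemma sum_codeg: "(\<Sum>k\<in>I. codeg j k) = (\<Sum>i\<in>I. A j i * deg i)"
  unfolding codeg_def deg_def by (subst sum.swap) (simp add: sum_distrib_left)

text \<open>The form \<open>l I + J / 2 - A\<close> applied to \<open>z\<close> minus its mean.\<close>

lemma centered_psd:
  "0 \<le> l * (\<Sum>i\<in>I. (z i)\<^sup>2) - (\<Sum>i\<in>I. \<Sum>j\<in>I. z i * z j * A i j)
     + 2 * sum z I / card I * (\<Sum>i\<in>I. z i * deg i)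
     - (sum z I)\<^sup>2 / card I * (sum deg I / card I + l)"
proof -
  define n :: real where "n = card I"
  define c where "c = sum z I / n"
  have n: "n > 0" using finite_vertices nonempty by (simp add: n_def card_gt_0_iff)
  have nc: "n * c = sum z I" using n by (simp add: c_def)
  have A_deg: "(\<Sum>i\<in>I. \<Sum>j\<in>I. z i * A i j) = (\<Sum>i\<in>I. z i * deg i)"
    "(\<Sum>i\<in>I. \<Sum>j\<in>I. z j * A i j) = (\<Sum>i\<in>I. z i * deg i)"
    "(\<Sum>i\<in>I. \<Sum>j\<in>I. A i j) = sum deg I"
    by (simp_all add: deg_def sum_distrib_left) (subst sum.swap, simp add: sym)
  \<comment> \<open>Centring removes the \<open>J\<close> term of \<open>psd\<close>.\<close>
  have "(\<Sum>i\<in>I. z i - c) = 0"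
    using nc by (simp add: sum_subtractf n_def)
  moreover have "(\<Sum>i\<in>I. (z i - c)\<^sup>2) = (\<Sum>i\<in>I. (z i)\<^sup>2) - 2 * c * sum z I + n * c\<^sup>2"
    by (simp add: power2_diff sum.distrib sum_subtractf n_def algebra_simps
        flip: sum_distrib_left sum_distrib_right)
  moreover have "(\<Sum>i\<in>I. \<Sum>j\<in>I. (z i - c) * (z j - c) * A i j)
      = (\<Sum>i\<in>I. \<Sum>j\<in>I. z i * z j * A i j) - 2 * c * (\<Sum>i\<in>I. z i * deg i) + c\<^sup>2 * sum deg I"
  proof -
    have "(\<Sum>i\<in>I. \<Sum>j\<in>I. (z i - c) * (z j - c) * A i j)
        = (\<Sum>i\<in>I. \<Sum>j\<in>I. z i * z j * A i j) - c * (\<Sum>i\<in>I. \<Sum>j\<in>I. z i * A i j)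
          - c * (\<Sum>i\<in>I. \<Sum>j\<in>I. z j * A i j) + c\<^sup>2 * (\<Sum>i\<in>I. \<Sum>j\<in>I. A i j)"
      by (simp add: sum_distrib_left power2_eq_square algebra_simps flip: sum.distrib sum_subtractf)
    then show ?thesis unfolding A_deg by simp
  qed
  ultimately have "0 \<le> l * ((\<Sum>i\<in>I. (z i)\<^sup>2) - 2 * c * sum z I + n * c\<^sup>2)
      - ((\<Sum>i\<in>I. \<Sum>j\<in>I. z i * z j * A i j) - 2 * c * (\<Sum>i\<in>I. z i * deg i) + c\<^sup>2 * sum deg I)"
    using psd[of "\<lambda>i. z i - c"] by simp
  also have "\<dots> = l * (\<Sum>i\<in>I. (z i)\<^sup>2) - (\<Sum>i\<in>I. \<Sum>j\<in>I. z i * z j * A i j)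
     + 2 * c * (\<Sum>i\<in>I. z i * deg i) - sum z I * c * (sum deg I / n + l)"
    unfolding nc[symmetric] using n by (simp add: power2_eq_square algebra_simps)
  finally show ?thesis
    by (simp add: c_def n_def power2_eq_square)
qed

text \<open>Tests the form on \<open>p e\<^sub>j + A e\<^sub>j + h A\<^sup>2 e\<^sub>j\<close>; the discarded terms count triangles and closed
  walks of length five.\<close>

lemma walk_test:
  assumes j: "j \<in> I" and p: "p \<ge> l" and h: "h \<ge> 0" and m: "\<And>i. i \<in> I \<Longrightarrow> deg i \<le> m"
  shows "0 \<le> l * p\<^sup>2 + (l + 2 * l * p * h - 2 * p) * deg j
      - (2 * h - l * h\<^sup>2) * (\<Sum>k\<in>I. (codeg j k)\<^sup>2)
      + (p + deg j + h * (\<Sum>k\<in>I. codeg j k))\<^sup>2 / card I * (2 * m - sum deg I / card I - l)"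
proof -
  define z where "z i = (if i = j then p else 0) + A j i + h * codeg j i" for i
  define Q T S where "Q = (\<Sum>k\<in>I. (codeg j k)\<^sup>2)" and "T = (\<Sum>k\<in>I. A j k * codeg j k)"
    and "S = (\<Sum>k\<in>I. codeg j k)"
  have n: "real (card I) > 0" using finite_vertices nonempty by (simp add: card_gt_0_iff)
  have T: "T \<ge> 0" by (simp add: T_def A_nonneg codeg_nonneg sum_nonneg)
  have z_nonneg: "z i \<ge> 0" for i
    using p l_pos h by (simp add: z_def A_nonneg codeg_nonneg)
  have sum_z: "sum z I = p + deg j + h * S"
    using j finite_vertices by (simp add: z_def sum.distrib deg_def S_def sum_distrib_left)
  have "(\<Sum>i\<in>I. (z i)\<^sup>2) = (\<Sum>i\<in>I. (if i = j then p\<^sup>2 + 2 * p * h * deg j else 0)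
      + A j i + h\<^sup>2 * (codeg j i)\<^sup>2 + 2 * h * (A j i * codeg j i))"
    using A_idem[of j] by (intro sum.cong refl)
      (auto simp: z_def irrefl codeg_self power2_eq_square algebra_simps)
  also have "\<dots> = p\<^sup>2 + 2 * p * h * deg j + deg j + h\<^sup>2 * Q + 2 * h * T"
    using j finite_vertices by (simp add: sum.distrib deg_def Q_def T_def sum_distrib_left)
  finally have sq: "(\<Sum>i\<in>I. (z i)\<^sup>2) = p\<^sup>2 + 2 * p * h * deg j + deg j + h\<^sup>2 * Q + 2 * h * T" .
  have Az: "(\<Sum>k\<in>I. z k * A i k) = p * A i j + codeg i j + h * (\<Sum>k\<in>I. codeg j k * A i k)" for i
  proof -
    have "(\<Sum>k\<in>I. z k * A i k) = (\<Sum>k\<in>I. (if k = j then p * A i j else 0) + A i k * A k j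
        + h * (codeg j k * A i k))"
      by (intro sum.cong refl) (auto simp: z_def sym[of j] algebra_simps)
    then show ?thesis
      using j finite_vertices by (simp add: sum.distrib codeg_def sum_distrib_left)
  qed
  have "(\<Sum>i\<in>I. \<Sum>k\<in>I. z i * z k * A i k) = (\<Sum>i\<in>I. z i * (\<Sum>k\<in>I. z k * A i k))"
    by (simp add: sum_distrib_left mult.assoc)
  also have "\<dots> \<ge> (\<Sum>i\<in>I. (if i = j then p * deg j + p * h * T else 0)
      + (A j i * p + A j i * codeg j i + h * (\<Sum>k\<in>I. codeg j k * A j i * A i k))
      + h * (p * (A j i * codeg j i) + (codeg j i)\<^sup>2))" (is "_ \<ge> ?R")
  proof (intro sum_mono)
    fix i assume "i \<in> I"
    have "0 \<le> h * codeg j i * (h * (\<Sum>k\<in>I. codeg j k * A i k))"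
      using h by (intro mult_nonneg_nonneg sum_nonneg) (auto simp: codeg_nonneg A_nonneg)
    moreover have "(\<Sum>k\<in>I. codeg j k * A j i * A i k) = A j i * (\<Sum>k\<in>I. codeg j k * A i k)"
      by (simp add: sum_distrib_left mult_ac)
    moreover have "(\<Sum>k\<in>I. codeg j k * A j k) = T" by (simp add: T_def mult.commute)
    ultimately show "(if i = j then p * deg j + p * h * T else 0)
        + (A j i * p + A j i * codeg j i + h * (\<Sum>k\<in>I. codeg j k * A j i * A i k))
        + h * (p * (A j i * codeg j i) + (codeg j i)\<^sup>2) \<le> z i * (\<Sum>k\<in>I. z k * A i k)"
      unfolding Az using A_idem[of j i]
      by (auto simp: z_def irrefl codeg_self codeg_sym[of i j] sym[of i j] power2_eq_square
          algebra_simps)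
  qed
  also have "?R = 2 * p * deg j + 2 * p * h * T + T + 2 * h * Q"
  proof -
    have "(\<Sum>i\<in>I. \<Sum>k\<in>I. codeg j k * A j i * A i k) = (\<Sum>k\<in>I. codeg j k * codeg j k)"
      by (subst sum.swap) (simp add: codeg_def[of j _] sum_distrib_left mult.assoc)
    then show ?thesis
      using j finite_vertices
      by (simp add: sum.distrib deg_def Q_def T_def power2_eq_square algebra_simps
          flip: sum_distrib_left)
  qed
  finally have form: "2 * p * deg j + 2 * p * h * T + T + 2 * h * Q
      \<le> (\<Sum>i\<in>I. \<Sum>k\<in>I. z i * z k * A i k)" .
  \<comment> \<open>Bounding all degrees by \<open>m\<close> turns the mean correction into a
    multiple of the squared total weight.\<close>
  have "(\<Sum>i\<in>I. z i * deg i) \<le> (\<Sum>i\<in>I. z i * m)"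
    using m z_nonneg by (intro sum_mono mult_left_mono) auto
  also have "\<dots> = m * sum z I" by (simp add: sum_distrib_left mult.commute)
  finally have "2 * sum z I / card I * (\<Sum>i\<in>I. z i * deg i) \<le> 2 * sum z I / card I * (m * sum z I)"
    using z_nonneg by (intro mult_left_mono) (auto simp: sum_nonneg)
  moreover have "2 * sum z I / card I * (m * sum z I) - (sum z I)\<^sup>2 / card I * (sum deg I / card I + l)
      = (sum z I)\<^sup>2 / card I * (2 * m - sum deg I / card I - l)"
    by (simp add: power2_eq_square algebra_simps)
  ultimately have main: "0 \<le> l * (p\<^sup>2 + 2 * p * h * deg j + deg j + h\<^sup>2 * Q + 2 * h * T)
      - (2 * p * deg j + 2 * p * h * T + T + 2 * h * Q)
      + (sum z I)\<^sup>2 / card I * (2 * m - sum deg I / card I - l)"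
    using centered_psd[of z] form unfolding sq by linarith
  \<comment> \<open>Because \<open>p \<ge> l\<close>, the triangle terms have nonpositive total and
    may be dropped.\<close>
  have "2 * l * h * T \<le> 2 * p * h * T + T"
    using T p h by (simp add: add_increasing2 mult_right_mono)
  with main have "0 \<le> l * p\<^sup>2 + (l + 2 * l * p * h - 2 * p) * deg j - (2 * h - l * h\<^sup>2) * Q
      + (sum z I)\<^sup>2 / card I * (2 * m - sum deg I / card I - l)"
    by (simp add: algebra_simps)
  then show ?thesis by (simp add: sum_z Q_def S_def)
qed

section \<open>Degree bounds drawn from the test vectors\<close>

lemma card_pos: "real (card I) > 0"
  using finite_vertices nonempty by (simp add: card_gt_0_iff)

lemma star_test:
  assumes j: "j \<in> I" and max: "\<And>i. i \<in> I \<Longrightarrow> deg i \<le> deg j"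
    and avg: "card I * l\<^sup>2 \<le> sum deg I" and dj: "deg j > l\<^sup>2"
  shows "card I * l * (deg j - l\<^sup>2) \<le> deg j * (l + 1)\<^sup>2 * (2 * deg j - l\<^sup>2 - l)"
proof -
  define N d where "N = real (card I)" and "d = deg j"
  have N: "N > 0" using card_pos by (simp add: N_def)
  have d: "d > 0" using dj l_pos by (simp add: d_def le_less_trans[OF zero_le_power2])
  have "l\<^sup>2 \<le> d" using dj by (simp add: d_def)
  then have "l \<le> d / l" using l_pos by (simp add: field_simps power2_eq_square)
  \<comment> \<open>Here \<open>order_refl\<close> sets \<open>h = 0\<close>, which leaves the star
    around \<open>j\<close>. The centre weight \<open>deg j / l\<close> minimises
    \<open>l * p\<^sup>2 - 2 * p * deg j\<close>.\<close>
  from walk_test[OF j this order_refl max]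
  have "0 \<le> l * (d / l)\<^sup>2 + (l - 2 * (d / l)) * d + (d / l + d)\<^sup>2 / N * (2 * d - sum deg I / N - l)"
    by (simp add: d_def N_def)
  also have "\<dots> \<le> l * (d / l)\<^sup>2 + (l - 2 * (d / l)) * d + (d / l + d)\<^sup>2 / N * (2 * d - l\<^sup>2 - l)"
    using avg N by (intro add_left_mono mult_left_mono) (auto simp: N_def field_simps)
  also have "\<dots> = d / (N * l\<^sup>2) * (d * (l + 1)\<^sup>2 * (2 * d - l\<^sup>2 - l) - N * l * (d - l\<^sup>2))"
    using N l_pos by (simp add: field_simps power2_eq_square)
  finally have "0 \<le> d / (N * l\<^sup>2) * (d * (l + 1)\<^sup>2 * (2 * d - l\<^sup>2 - l) - N * l * (d - l\<^sup>2))" .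
  moreover have "0 < d / (N * l\<^sup>2)" using d N l_pos by simp
  ultimately have "0 \<le> d * (l + 1)\<^sup>2 * (2 * d - l\<^sup>2 - l) - N * l * (d - l\<^sup>2)"
    by (metis mult_le_cancel_left_pos mult_zero_right)
  then show ?thesis by (simp add: N_def d_def)
qed

text \<open>The diagonal term is exactly \<open>(deg j)\<^sup>2\<close>; integrality handles all
  others.\<close>

lemma sum_codeg_squared_ge: 
  assumes "j \<in> I"
  shows "(deg j)\<^sup>2 + (\<Sum>k\<in>I. codeg j k) - deg j \<le> (\<Sum>k\<in>I. (codeg j k)\<^sup>2)"
proof -
  have "(\<Sum>k\<in>I. codeg j k) + ((deg j)\<^sup>2 - deg j)
      = (\<Sum>k\<in>I. codeg j k + (if k = j then (deg j)\<^sup>2 - deg j else 0))"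
    using assms finite_vertices by (simp add: sum.distrib)
  also have "\<dots> \<le> (\<Sum>k\<in>I. (codeg j k)\<^sup>2)"
    by (intro sum_mono) (auto simp: codeg_self codeg_squared_ge)
  finally show ?thesis by simp
qed

text \<open>An average degree above \<open>l\<^sup>2\<close> would let the star test bring every
  degree down to \<open>l\<^sup>2 + l / 4\<close>; \<open>walk_test\<close> summed over all vertices
  then contradicts \<open>walk_test_gap\<close>.\<close>

lemma sum_deg_le:
  assumes l: "l \<ge> 3/2" and N: "real (card I) \<ge> 2 * l * (l + 1) * (4 * l\<^sup>2 + 4 * l - 1)"
    and deg_le: "\<And>i. i \<in> I \<Longrightarrow> deg i \<le> l ^ 3 + l\<^sup>2 / 2 + l / 2"
  shows "sum deg I \<le> card I * l\<^sup>2"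
proof (rule ccontr)
  assume "\<not> sum deg I \<le> card I * l\<^sup>2"
  then have avg: "card I * l\<^sup>2 < sum deg I" by simp
  \<comment> \<open>The value of \<open>h\<close> makes \<open>2 * l\<^sup>2 * h = 1\<close>, so
    that for \<open>p = l\<close> the degree has coefficient \<open>1 - l\<close> in
    \<open>walk_test\<close>.\<close>
  define n m h where "n = real (card I)" and "m = l\<^sup>2 + l / 4" and "h = 1 / (2 * l\<^sup>2)"
  have n: "n > 0" using card_pos by (simp add: n_def)
  define a where "a = sum deg I / n"
  have a: "a > l\<^sup>2" "sum deg I = n * a"
    using avg n by (simp_all add: a_def n_def less_divide_eq mult.commute)
  obtain j where j: "j \<in> I" "\<And>i. i \<in> I \<Longrightarrow> deg i \<le> deg j"
    using obtains_MAX[OF finite_vertices nonempty, of deg] finite_vertices by (metis Max_ge finite_imageI imageI)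
  have "sum deg I \<le> card I * deg j"
    using sum_bounded_above[of I deg "deg j"] j by simp
  with avg have "n * l\<^sup>2 < n * deg j" by (simp add: n_def)
  then have "l\<^sup>2 < deg j" using n by simp
  then have "deg j \<le> m"
    unfolding m_def using l N j avg deg_le[of j]
    by (intro star_test_gap[of l "real (card I)"] star_test) auto
  then have m: "\<And>i. i \<in> I \<Longrightarrow> deg i \<le> m" using j by (meson order_trans)
  have h: "0 < h" "2 * h - l * h\<^sup>2 = 1 / l\<^sup>2 - 1 / (4 * l ^ 3)" "2 * l * l * h = 1"
    using l by (simp_all add: h_def field_simps power2_eq_square power3_eq_cube)
  have l2: "l\<^sup>2 \<ge> l" using l by (simp add: power2_eq_square)
  have h': "2 * h - l * h\<^sup>2 \<ge> 0"
    unfolding h(2) using l by (simp add: field_simps power2_eq_square power3_eq_cube)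
  define s where "s = l + m + h * m\<^sup>2"
  have each: "0 \<le> l ^ 3 + (1 - l) * deg i - (2 * h - l * h\<^sup>2) * ((deg i)\<^sup>2 + (\<Sum>k\<in>I. codeg i k) - deg i)
      + s\<^sup>2 / n * (2 * m - l\<^sup>2 - l)" if i: "i \<in> I" for i
  proof -
    define S where "S = (\<Sum>k\<in>I. codeg i k)"
    have "S \<le> (\<Sum>k\<in>I. A i k * m)"
      unfolding S_def sum_codeg using m by (intro sum_mono mult_left_mono A_nonneg) auto
    also have "\<dots> = deg i * m" by (simp add: deg_def sum_distrib_right)
    also have "\<dots> \<le> m * m"
      using m[OF i] deg_nonneg[of i] by (intro mult_right_mono) auto
    finally have S: "0 \<le> S" "S \<le> m\<^sup>2"
      by (auto simp: S_def codeg_nonneg sum_nonneg power2_eq_square)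
    have cube: "l * l\<^sup>2 = l ^ 3" by (simp add: power2_eq_square power3_eq_cube)
    have coeff: "l + 2 * l * l * h - 2 * l = 1 - l" using h(3) by simp
    have walk: "0 \<le> l * l\<^sup>2 + (l + 2 * l * l * h - 2 * l) * deg i
        - (2 * h - l * h\<^sup>2) * (\<Sum>k\<in>I. (codeg i k)\<^sup>2)
        + (l + deg i + h * S)\<^sup>2 / n * (2 * m - a - l)"
      using walk_test[where p = l and h = h and m = m, OF i order_refl _ m] h(1) by (simp add: a_def n_def S_def)
    have "(2 * h - l * h\<^sup>2) * ((deg i)\<^sup>2 + S - deg i)
        \<le> (2 * h - l * h\<^sup>2) * (\<Sum>k\<in>I. (codeg i k)\<^sup>2)"
      unfolding S_def by (intro mult_left_mono sum_codeg_squared_ge i h')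
    moreover have "(l + deg i + h * S)\<^sup>2 / n * (2 * m - a - l) \<le> s\<^sup>2 / n * (2 * m - l\<^sup>2 - l)"
    proof -
      have "(l + deg i + h * S)\<^sup>2 / n * (2 * m - a - l) \<le> (l + deg i + h * S)\<^sup>2 / n * (2 * m - l\<^sup>2 - l)"
        using a n by (intro mult_left_mono) auto
      also have "\<dots> \<le> s\<^sup>2 / n * (2 * m - l\<^sup>2 - l)"
      proof (intro mult_right_mono divide_right_mono power_mono)
        have "h * S \<le> h * m\<^sup>2" using S h by (intro mult_left_mono) auto
        then show "l + deg i + h * S \<le> s" using m[OF i] by (simp add: s_def)
        show "0 \<le> l + deg i + h * S" using l deg_nonneg[of i] S h by simp
        show "0 \<le> 2 * m - l\<^sup>2 - l" using l2 l by (simp add: m_def)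
      qed (use n in auto)
      finally show ?thesis .
    qed
    ultimately show ?thesis
      using walk unfolding cube coeff S_def by linarith
  qed
  \<comment> \<open>The codegrees add up to the sum of squared degrees, so the squared average
    degree enters twice below.\<close>
  have "(\<Sum>i\<in>I. \<Sum>k\<in>I. codeg i k) = (\<Sum>i\<in>I. (deg i)\<^sup>2)"
  proof -
    have "(\<Sum>i\<in>I. \<Sum>k\<in>I. codeg i k) = (\<Sum>k\<in>I. \<Sum>i\<in>I. A i k * deg k)"
      unfolding sum_codeg by (rule sum.swap)
    also have "\<dots> = (\<Sum>k\<in>I. (deg k)\<^sup>2)"
    proof (intro sum.cong refl)
      fix k show "(\<Sum>i\<in>I. A i k * deg k) = (deg k)\<^sup>2"
        by (simp add: deg_def sym[of _ k] power2_eq_square flip: sum_distrib_right)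
    qed
    finally show ?thesis .
  qed
  moreover have "(n * a)\<^sup>2 \<le> (\<Sum>i\<in>I. (deg i)\<^sup>2) * n"
    using sum_squared_le_sum_of_squares[of deg I] by (simp add: a(2) n_def)
  then have "n * a\<^sup>2 \<le> (\<Sum>i\<in>I. (deg i)\<^sup>2)"
    using n by (simp add: power_mult_distrib power2_eq_square mult_ac)
  ultimately have "2 * n * a\<^sup>2 - n * a \<le> (\<Sum>i\<in>I. (deg i)\<^sup>2 + (\<Sum>k\<in>I. codeg i k) - deg i)"
    by (simp add: sum.distrib sum_subtractf a(2))
  then have "(2 * h - l * h\<^sup>2) * (2 * n * a\<^sup>2 - n * a)
      \<le> (2 * h - l * h\<^sup>2) * (\<Sum>i\<in>I. (deg i)\<^sup>2 + (\<Sum>k\<in>I. codeg i k) - deg i)"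
    by (intro mult_left_mono h')
  moreover have "0 \<le> (\<Sum>i\<in>I. l ^ 3 + (1 - l) * deg i
      - (2 * h - l * h\<^sup>2) * ((deg i)\<^sup>2 + (\<Sum>k\<in>I. codeg i k) - deg i)
      + s\<^sup>2 / n * (2 * m - l\<^sup>2 - l))"
    by (intro sum_nonneg each)
  then have "0 \<le> n * l ^ 3 + (1 - l) * (n * a)
      - (2 * h - l * h\<^sup>2) * (\<Sum>i\<in>I. (deg i)\<^sup>2 + (\<Sum>k\<in>I. codeg i k) - deg i)
      + n * (s\<^sup>2 / n * (2 * m - l\<^sup>2 - l))"
    unfolding a(2)[symmetric] sum_distrib_left
    by (simp only: sum.distrib sum_subtractf sum_constant n_def)
  ultimately have "0 \<le> n * (l ^ 3 + (1 - l) * a - (2 * h - l * h\<^sup>2) * (2 * a\<^sup>2 - a)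
      + s\<^sup>2 / n * (2 * m - l\<^sup>2 - l))"
    by (simp add: algebra_simps)
  then have "0 \<le> l ^ 3 + (1 - l) * a - (2 * h - l * h\<^sup>2) * (2 * a\<^sup>2 - a) + s\<^sup>2 / n * (2 * m - l\<^sup>2 - l)"
    using n by (simp add: zero_le_mult_iff)
  moreover have "(1 - l) * a \<le> (1 - l) * l\<^sup>2"
    using a l by (intro mult_left_mono_neg) auto
  moreover have "2 * l ^ 4 - l\<^sup>2 \<le> 2 * a\<^sup>2 - a"
  proof -
    have "0 \<le> a - l\<^sup>2" "0 \<le> 2 * (a + l\<^sup>2) - 1"
      using a(1) l l2 by simp_all
    then have "0 \<le> (a - l\<^sup>2) * (2 * (a + l\<^sup>2) - 1)"
      by (rule mult_nonneg_nonneg)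
    then show ?thesis by (simp add: power2_eq_square power4_eq_xxxx algebra_simps)
  qed
  then have "(2 * h - l * h\<^sup>2) * (2 * l ^ 4 - l\<^sup>2) \<le> (2 * h - l * h\<^sup>2) * (2 * a\<^sup>2 - a)"
    by (intro mult_left_mono h')
  moreover have "s\<^sup>2 / n * (2 * m - l\<^sup>2 - l) < (2 * h - l * h\<^sup>2) * (2 * l ^ 4 - l\<^sup>2) - l\<^sup>2"
    using walk_test_gap[OF l N] unfolding h(2) s_def m_def n_def by (simp add: h_def)
  moreover have "(1 - l) * l\<^sup>2 = l\<^sup>2 - l ^ 3"
    by (simp add: power2_eq_square power3_eq_cube algebra_simps)
  ultimately show False by linarith
qed

text \<open>Degrees are at most one, so the graph is a matching. Each vertex outside a maximal
  independent set has a neighbour inside, and no two of them share it.\<close>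

lemma half_independent:
  assumes "\<And>i. i \<in> I \<Longrightarrow> deg i < 2"
  obtains J where "J \<subseteq> I" "card I \<le> 2 * card J" "\<And>i j. \<lbrakk>i \<in> J; j \<in> J\<rbrakk> \<Longrightarrow> A i j = 0"
proof -
  define F where "F = {J. J \<subseteq> I \<and> (\<forall>i\<in>J. \<forall>j\<in>J. A i j = 0)}"
  have "finite F" "{} \<in> F" using finite_vertices by (auto simp: F_def)
  then obtain J where J: "J \<in> F" "\<And>K. K \<in> F \<Longrightarrow> J \<subseteq> K \<Longrightarrow> J = K"
    using finite_has_maximal[of F] by (metis empty_iff)
  have finJ: "finite J" "J \<subseteq> I" using J(1) finite_vertices by (auto simp: F_def finite_subset)
  have "\<exists>j\<in>J. A i j = 1" if "i \<in> I - J" for i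
  proof (rule ccontr)
    assume "\<not> ?thesis"
    then have "\<forall>j\<in>J. A i j = 0" using zero_one by blast
    then have "insert i J \<in> F"
      using J(1) that irrefl sym[of _ i] by (auto simp: F_def)
    then show False using J(2)[of "insert i J"] that by auto
  qed
  then obtain f where f: "\<And>i. i \<in> I - J \<Longrightarrow> f i \<in> J \<and> A i (f i) = 1"
    by metis
  have "inj_on f (I - J)"
  proof (rule inj_onI, rule ccontr)
    fix i k assume ik: "i \<in> I - J" "k \<in> I - J" "f i = f k" "i \<noteq> k"
    have "(\<Sum>x\<in>{i, k}. A (f i) x) \<le> deg (f i)"
      unfolding deg_def using ik finite_vertices by (intro sum_mono2) (auto simp: A_nonneg)
    moreover have "(\<Sum>x\<in>{i, k}. A (f i) x) = 2"
      using ik f[of i] f[of k] sym by simp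
    ultimately show False using assms[of "f i"] f[of i] ik finJ by auto
  qed
  then have "card (I - J) \<le> card J"
    using f finJ by (intro card_inj_on_le[of f]) auto
  then have "card I \<le> 2 * card J"
    using finJ finite_vertices by (simp add: card_Diff_subset)
  then show ?thesis using that finJ J(1) by (auto simp: F_def)
qed

end

section \<open>Bounds on the size of an equiangular family\<close>

context equiangular_family
begin

section \<open>The Gram matrix in terms of the graph of negative products\<close>

definition adj :: "'i \<Rightarrow> 'i \<Rightarrow> real" where
  "adj i j = of_bool (i \<noteq> j \<and> v i \<bullet> v j < 0)"

lemma adj_nonneg: "adj i j \<ge> 0"
  by (simp add: adj_def)

lemma inner_adj:
  assumes "i \<in> I" "j \<in> I"
  shows "(2 * l + 1) * (v i \<bullet> v j) = (if i = j then 2 * l else 0) + 1 - 2 * adj i j"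
proof (cases "i = j")
  case True
  then show ?thesis using unit[OF assms(1)] by (simp add: adj_def)
next
  case False
  have "(2 * l + 1) * \<bar>v i \<bullet> v j\<bar> = 1"
    using angle[OF assms False] l_pos by simp
  then show ?thesis
    using False by (cases "v i \<bullet> v j < 0") (auto simp: adj_def)
qed

lemma norm_combination:
  "(2 * l + 1) * ((\<Sum>i\<in>I. z i *\<^sub>R v i) \<bullet> (\<Sum>i\<in>I. z i *\<^sub>R v i))
    = 2 * l * (\<Sum>i\<in>I. (z i)\<^sup>2) + (sum z I)\<^sup>2 - 2 * (\<Sum>i\<in>I. \<Sum>j\<in>I. z i * z j * adj i j)"
proof -
  have "(2 * l + 1) * ((\<Sum>i\<in>I. z i *\<^sub>R v i) \<bullet> (\<Sum>i\<in>I. z i *\<^sub>R v i))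
      = (\<Sum>i\<in>I. \<Sum>j\<in>I. z i * z j * ((2 * l + 1) * (v i \<bullet> v j)))"
    unfolding inner_sum_left inner_sum_right
    by (subst sum.swap) (simp add: sum_distrib_left mult_ac)
  also have "\<dots> = (\<Sum>i\<in>I. \<Sum>j\<in>I. (if i = j then 2 * l * (z i)\<^sup>2 else 0) + z i * z j
      - 2 * (z i * z j * adj i j))"
  proof (intro sum.cong refl)
    fix i j assume "i \<in> I" "j \<in> I"
    show "z i * z j * ((2 * l + 1) * (v i \<bullet> v j))
        = (if i = j then 2 * l * (z i)\<^sup>2 else 0) + z i * z j - 2 * (z i * z j * adj i j)"
      unfolding inner_adj[OF \<open>i \<in> I\<close> \<open>j \<in> I\<close>]
      by (auto simp: power2_eq_square algebra_simps)
  qed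
  also have "\<dots> = 2 * l * (\<Sum>i\<in>I. (z i)\<^sup>2) + (sum z I)\<^sup>2 - 2 * (\<Sum>i\<in>I. \<Sum>j\<in>I. z i * z j * adj i j)"
    unfolding power2_eq_square[of "sum z I"] sum_product
    using fin by (simp add: sum.distrib sum_subtractf sum_distrib_left)
  finally show ?thesis .
qed

text \<open>\<open>l I + J / 2 - A\<close> is a positive multiple of the Gram matrix.\<close>

lemma psd_graph_adj:
  assumes "I \<noteq> {}"
  shows "psd_graph I adj l"
proof
  fix z :: "'i \<Rightarrow> real"
  have "0 \<le> (2 * l + 1) * ((\<Sum>i\<in>I. z i *\<^sub>R v i) \<bullet> (\<Sum>i\<in>I. z i *\<^sub>R v i))"
    using l_pos by simp
  then show "0 \<le> l * (\<Sum>i\<in>I. (z i)\<^sup>2) + (sum z I)\<^sup>2 / 2 - (\<Sum>i\<in>I. \<Sum>j\<in>I. z i * z j * adj i j)"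
    unfolding norm_combination by simp
qed (use assms fin l_pos in \<open>auto simp: adj_def inner_commute\<close>)

text \<open>By \<open>eigenvector_coordinate\<close> each coordinate \<open>x j\<close> is at least
  some \<open>r > 0\<close>. Every neighbour of \<open>i\<close> thus uses up at least
  \<open>r\<close> in row \<open>i\<close> of the eigenvector equation, and the available total is
  bounded through \<open>sum x I\<close>.\<close>

lemma degree_less:
  assumes l: "l \<ge> 1/2" and n: "n \<ge> b * (2 * b - 1)" "l > 1/2 \<or> n > b * (2 * b - 1)"
    and u: "u \<bullet> u = 1" and eig: "(\<Sum>i\<in>I. (u \<bullet> v i) *\<^sub>R v i) = y *\<^sub>R u" and y: "y > D"
    and signs: "\<And>i. i \<in> I \<Longrightarrow> u \<bullet> v i \<ge> 0" and i: "i \<in> I"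
  shows "(\<Sum>j\<in>I. adj i j) < l ^ 3 + l\<^sup>2 / 2 + l / 2"
proof -
  define s w c where "s = 2 * l + 1" and "w = n / b" and "c = b * (l - 1/2)"
  define x where "x j = u \<bullet> v j" for j
  have nb: "n = b * w" using b_pos by (simp add: w_def)
  have b2: "2 * b - 1 = 4 * l\<^sup>2 + 4 * l - 1" by (simp add: b_def power2_eq_square algebra_simps)
  have w: "w \<ge> 4 * l\<^sup>2 + 4 * l - 1" "l > 1/2 \<or> w > 4 * l\<^sup>2 + 4 * l - 1"
    using n b_pos unfolding nb b2 by auto
  have D: "D = b * (w + 2) / (2 * l + 1)\<^sup>2" by (simp add: D_def nb algebra_simps)
  have s: "s > 0" "s\<^sup>2 = 2 * b + 1"
    by (use l in \<open>simp_all add: s_def b_def power2_eq_square algebra_simps\<close>)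
  have "b * s\<^sup>2 \<le> b * (w + 2)"
    using w(1) b2 b_pos s(2) by (intro mult_left_mono) auto
  moreover have D': "D = b * (w + 2) / s\<^sup>2" by (simp add: D s_def)
  ultimately have bD: "b \<le> D" using s(1) by (simp add: le_divide_eq)
  have y_pos: "y > 0" using y D_pos by simp
  have "b * D < y * y"
    using bD y D_pos b_pos by (intro mult_strict_mono') auto
  then have den: "y\<^sup>2 - b * D > 0" by (simp add: power2_eq_square)
  have main: "y * (y\<^sup>2 - b * D) < D * (y - b) * (2 * s * y - n + 2 * c)"
    using degree_cubic_scaled[OF l w b_def D y y_pos] eigenvalue_cubic[OF u eig]
      eigenvalue_squared_le[OF u eig y_pos]
    by (simp add: nb s_def c_def)
  \<comment> \<open>The lower bound on \<open>(x j)\<^sup>2\<close> obtained by solving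
    \<open>eigenvector_coordinate\<close> for it.\<close>
  define t where "t = D * (y - b) / (y\<^sup>2 - b * D)"
  have t: "t > 0" using den D_pos y bD by (simp add: t_def)
  have yt: "y < t * (2 * s * y - n + 2 * c)"
    using main den by (simp add: t_def less_divide_eq)
  define r where "r = sqrt t"
  have r: "r > 0" "r * r = t" using t by (simp_all add: r_def)
  have x_ge: "r \<le> x j" if "j \<in> I" for j
  proof (rule power2_le_imp_le)
    have "y * (1 - y * (x j)\<^sup>2 / D) * D \<le> b * (1 - (x j)\<^sup>2) * D"
      using eigenvector_coordinate[OF u eig that] D_pos unfolding x_def
      by (intro mult_right_mono) auto
    then have "D * (y - b) \<le> (x j)\<^sup>2 * (y\<^sup>2 - b * D)"
      using D_pos by (simp add: power2_eq_square algebra_simps)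
    then have "t \<le> (x j)\<^sup>2" using den by (simp add: t_def divide_le_eq)
    then show "r\<^sup>2 \<le> (x j)\<^sup>2" using r(2) by (simp add: power2_eq_square)
  qed (use signs that in \<open>simp add: x_def\<close>)
  define X where "X = sum x I"
  have "s * (y * x i) = (\<Sum>j\<in>I. x j * (s * (v i \<bullet> v j)))"
    using arg_cong[OF eig, of "\<lambda>z. s * (v i \<bullet> z)"]
    by (simp add: inner_sum_right sum_distrib_left x_def inner_commute[of "v i" u] mult_ac)
  also have "\<dots> = (\<Sum>j\<in>I. (if j = i then 2 * l * x i else 0) + x j - 2 * (adj i j * x j))"
  proof (intro sum.cong refl)
    fix j assume "j \<in> I"
    then have "s * (v i \<bullet> v j) = (if i = j then 2 * l else 0) + 1 - 2 * adj i j"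
      using i by (simp only: s_def inner_adj)
    then show "x j * (s * (v i \<bullet> v j)) = (if j = i then 2 * l * x i else 0) + x j - 2 * (adj i j * x j)"
      by (simp only:) (auto simp: algebra_simps)
  qed
  also have "\<dots> = 2 * l * x i + X - 2 * (\<Sum>j\<in>I. adj i j * x j)"
    using fin i by (simp add: sum.distrib sum_subtractf X_def sum_distrib_left)
  finally have row: "2 * (\<Sum>j\<in>I. adj i j * x j) = X - (s * y - 2 * l) * x i"
    by (simp add: algebra_simps)
  have "(\<Sum>j\<in>I. adj i j) * r \<le> (\<Sum>j\<in>I. adj i j * x j)"
    unfolding sum_distrib_right using x_ge by (intro sum_mono mult_left_mono adj_nonneg)
  moreover have "(s * y - 2 * l) * r \<le> (s * y - 2 * l) * x i"
  proof (intro mult_left_mono x_ge i)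
    have "2 * l \<le> 1 * b" using l by (simp add: b_def)
    also have "\<dots> \<le> s * y" using l bD y b_pos by (intro mult_mono) (auto simp: s_def)
    finally show "0 \<le> s * y - 2 * l" by simp
  qed
  ultimately have "2 * ((\<Sum>j\<in>I. adj i j) * r) \<le> X - (s * y - 2 * l) * r"
    using row by linarith
  then have "2 * ((\<Sum>j\<in>I. adj i j) * r) * r \<le> (X - (s * y - 2 * l) * r) * r"
    using r by (intro mult_right_mono) auto
  then have deg: "2 * ((\<Sum>j\<in>I. adj i j) * t) \<le> X * r - (s * y - 2 * l) * t"
    by (simp add: algebra_simps flip: r(2))
  \<comment> \<open>AM-GM against \<open>r\<close>: the squares add up to \<open>y\<close>, which
    \<open>yt\<close> then bounds by a multiple of \<open>t\<close>.\<close>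
  have "2 * (X * r) = (\<Sum>j\<in>I. 2 * x j * r)"
    by (simp add: X_def sum_distrib_left sum_distrib_right mult.assoc)
  also have "\<dots> \<le> (\<Sum>j\<in>I. (x j)\<^sup>2 + r\<^sup>2)"
    by (intro sum_mono sum_squares_bound)
  also have "\<dots> = y + n * t"
    using form_value[OF u eig] r(2) by (simp add: sum.distrib x_def n_def power2_eq_square)
  finally have "2 * (2 * ((\<Sum>j\<in>I. adj i j) * t)) < t * (2 * s * y - n + 2 * c) + n * t - 2 * ((s * y - 2 * l) * t)"
    using deg yt by linarith
  \<comment> \<open>All terms in \<open>n\<close> and \<open>y\<close> cancel, which leaves a bound
    in \<open>l\<close> alone.\<close>
  also have "\<dots> = 4 * ((l ^ 3 + l\<^sup>2 / 2 + l / 2) * t)"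
    by (simp add: c_def b_def power2_eq_square power3_eq_cube field_simps)
  finally have "(\<Sum>j\<in>I. adj i j) * t < (l ^ 3 + l\<^sup>2 / 2 + l / 2) * t" by simp
  then show ?thesis using t by simp
qed

text \<open>\<open>rank_bound\<close> for \<open>u\<close> along the sum of the family. Average
  degree at most \<open>d\<close> makes the form value \<open>q\<close> at least \<open>t\<close>,
  and \<open>n \<le> t * (1 + R)\<close> allows \<open>q\<close> to be replaced by
  \<open>t\<close>.\<close>

lemma rank_average:
  assumes ne: "I \<noteq> {}" and avg: "(\<Sum>i\<in>I. \<Sum>j\<in>I. adj i j) \<le> n * d"
    and t: "(2 * l + 1) * t = n + 2 * l - 2 * d" "t > 0"
    and R: "real (dim (span (v ` I))) - 1 \<le> R" "n \<le> t * (1 + R)"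
  shows "(n - t)\<^sup>2 \<le> R * (n * D - t\<^sup>2)"
proof -
  have n: "n > 0" using ne fin by (simp add: n_def card_gt_0_iff)
  define S where "S = (\<Sum>i\<in>I. v i)"
  have "(2 * l + 1) * (S \<bullet> S) = 2 * l * n + n\<^sup>2 - 2 * (\<Sum>i\<in>I. \<Sum>j\<in>I. adj i j)"
    using norm_combination[of "\<lambda>_. 1"] by (simp add: S_def n_def)
  moreover have "(2 * l + 1) * (n * t) = n * (n + 2 * l - 2 * d)"
    unfolding t(1)[symmetric] by simp
  then have "(2 * l + 1) * (n * t) = 2 * l * n + n\<^sup>2 - 2 * (n * d)"
    by (simp add: power2_eq_square algebra_simps)
  ultimately have "(2 * l + 1) * (n * t) \<le> (2 * l + 1) * (S \<bullet> S)"
    using avg by linarith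
  then have SS: "n * t \<le> S \<bullet> S" using l_pos by simp
  moreover have "0 < n * t" using n t(2) by simp
  ultimately have "S \<noteq> 0" by auto
  then have S: "norm S > 0" by simp
  define u where "u = S /\<^sub>R norm S"
  define q where "q = (\<Sum>i\<in>I. (u \<bullet> v i)\<^sup>2)"
  have u: "u \<bullet> u = 1" using S by (simp add: u_def dot_square_norm power2_eq_square)
  have uS: "u \<in> span (v ` I)"
    unfolding u_def S_def by (intro span_scale span_sum) (auto intro: span_base)
  have "(\<Sum>i\<in>I. u \<bullet> v i) = u \<bullet> S" by (simp add: S_def inner_sum_right)
  also have "\<dots> = norm S"
    using S by (simp add: u_def dot_square_norm power2_eq_square)
  finally have "(\<Sum>i\<in>I. u \<bullet> v i) = norm S" .
  then have "(norm S)\<^sup>2 \<le> q * n"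
    using sum_squared_le_sum_of_squares[of "\<lambda>i. u \<bullet> v i" I] by (simp add: q_def n_def)
  then have "n * t \<le> n * q" using SS by (simp add: dot_square_norm mult.commute)
  then have q: "t \<le> q" using n by simp
  have "(n - q)\<^sup>2 \<le> (real (dim (span (v ` I))) - 1) * (n * D - q\<^sup>2)"
    by (rule rank_bound[OF u uS q_def])
  also have "\<dots> \<le> R * (n * D - q\<^sup>2)"
    using rank_bound(2)[OF u uS q_def] R(1) by (intro mult_right_mono) auto
  finally have 1: "(n - q)\<^sup>2 \<le> R * (n * D - q\<^sup>2)" .
  have "0 < t * (1 + R)" using R(2) n by linarith
  then have "1 + R > 0" using t(2) by (simp add: zero_less_mult_iff)
  then have "t * (1 + R) \<le> q * (1 + R)" using q by (intro mult_right_mono) auto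
  \<comment> \<open>This product is exactly the change in right side minus left side when
    \<open>q\<close> is lowered to \<open>t\<close>.\<close>
  then have "0 \<le> (q - t) * (q * (1 + R) + t * (1 + R) - 2 * n)"
    using q R(2) by (intro mult_nonneg_nonneg) auto
  then show ?thesis using 1 by (simp add: power2_eq_square algebra_simps)
qed

section \<open>Lower bounds for the dimension of the span\<close>

lemma scaled_D: "(2 * l + 1)\<^sup>2 * D = n + 2 * b"
  using l_pos by (simp add: D_def)

text \<open>At average degree \<open>l\<^sup>2\<close> both sides of \<open>rank_average\<close>,
  after scaling, share the factor \<open>4 * l\<^sup>2\<close>. With \<open>q = l - 1\<close> and
  \<open>p = q\<^sup>2 / 2\<close> the negated claim reduces to
  \<open>(p + q)\<^sup>2 \<le> 0\<close>.\<close>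

lemma dim_bound_sparse:
  assumes ne: "I \<noteq> {}" and l: "l > 1" and n: "n \<ge> b * (2 * b - 1)"
    and avg: "(\<Sum>i\<in>I. \<Sum>j\<in>I. adj i j) \<le> n * l\<^sup>2"
  shows "n + (l + 1)\<^sup>2 / 2 < 2 * real (dim (span (v ` I)))"
proof (rule ccontr)
  assume not_less: "\<not> ?thesis"
  \<comment> \<open>\<open>R\<close> is the bound on the dimension minus one given by the negated
    claim; \<open>t\<close> belongs to average degree \<open>l\<^sup>2\<close>.\<close>
  define s q p R t where "s = 2 * l + 1" and "q = l - 1" and "p = q\<^sup>2 / 2"
    and "R = n / 2 + (l + 1)\<^sup>2 / 4 - 1" and "t = (n + 2 * l - 2 * l\<^sup>2) / s"
  have s: "s > 0" "s * t = n + 2 * l - 2 * l\<^sup>2" using l by (simp_all add: s_def t_def)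
  have "1 * 2 \<le> l * (l + 1)" using l by (intro mult_mono) auto
  then have b4: "b \<ge> 4" by (simp add: b_def)
  then have "b * 7 \<le> b * (2 * b - 1)" by (intro mult_left_mono) auto
  then have nb: "n \<ge> 7 * b" using n by simp
  have b': "b = 2 * l\<^sup>2 + 2 * l" by (simp add: b_def power2_eq_square algebra_simps)
  have "2 * s \<le> s * t"
    unfolding s(2) using nb b4 b' l by (simp add: s_def)
  then have t2: "t \<ge> 2" using s(1) by simp
  have "2 * (n / 2) \<le> t * (1 + R)"
    using t2 n_nonneg by (intro mult_mono) (auto simp: R_def)
  then have "n \<le> t * (1 + R)" by simp
  then have "(n - t)\<^sup>2 \<le> R * (n * D - t\<^sup>2)"
    using not_less t2 s(2) by (intro rank_average[OF ne avg]) (auto simp: s_def R_def)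
  then have "s\<^sup>2 * (n - t)\<^sup>2 \<le> s\<^sup>2 * (R * (n * D - t\<^sup>2))"
    by (intro mult_left_mono) auto
  also have "s\<^sup>2 * (R * (n * D - t\<^sup>2)) = R * (n * (n + 2 * b) - (s * t)\<^sup>2)"
    unfolding scaled_D[folded s_def, symmetric] by (simp add: power_mult_distrib algebra_simps)
  also have "s\<^sup>2 * (n - t)\<^sup>2 = (s * n - s * t)\<^sup>2"
    by (simp add: power_mult_distrib flip: right_diff_distrib)
  finally have "(s * n - s * t)\<^sup>2 \<le> R * (n * (n + 2 * b) - (s * t)\<^sup>2)" .
  moreover have "s * n - s * t = 2 * l * (n + q)"
    unfolding s(2) by (simp add: s_def q_def power2_eq_square algebra_simps)
  moreover have "n * (n + 2 * b) - (s * t)\<^sup>2 = 8 * l\<^sup>2 * (n - p)"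
    unfolding s(2) by (simp add: b_def q_def p_def power2_eq_square field_simps)
  moreover have "R = (n + p + 2 * q) / 2"
    by (simp add: R_def p_def q_def power2_eq_square field_simps)
  ultimately have "(2 * l * (n + q))\<^sup>2 \<le> (n + p + 2 * q) / 2 * (8 * l\<^sup>2 * (n - p))"
    by simp
  moreover have "(2 * l * (n + q))\<^sup>2 = 4 * l\<^sup>2 * (n + q)\<^sup>2"
    unfolding power_mult_distrib[of "2 * l"] by (simp add: power2_eq_square)
  ultimately have "4 * l\<^sup>2 * (n + q)\<^sup>2 \<le> 4 * l\<^sup>2 * ((n + p + 2 * q) * (n - p))"
    by (simp add: mult_ac)
  then have "(n + q)\<^sup>2 \<le> (n + p + 2 * q) * (n - p)"
    using l by simp
  then have "q\<^sup>2 + p\<^sup>2 + 2 * p * q \<le> 0"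
    by (simp add: power2_eq_square algebra_simps)
  moreover have "q > 0" "p \<ge> 0" using l by (simp_all add: q_def p_def)
  ultimately show False
    by (smt (verit) mult_nonneg_nonneg zero_le_power2 zero_less_power)
qed

text \<open>If the claim failed, the rank inequality would force \<open>n * (d - l\<^sup>2)\<close>
  to be large, whereas \<open>star\<close> bounds it from above.\<close>

lemma dim_bound_star:
  assumes ne: "I \<noteq> {}" and l: "1 \<le> l" "l \<le> 3/2" and n: "n \<ge> b * (2 * b - 1)"
    and d: "l\<^sup>2 < d" "d \<le> l\<^sup>2 + l / 4"
    and avg: "(\<Sum>i\<in>I. \<Sum>j\<in>I. adj i j) \<le> n * d"
    and star: "n * l * (d - l\<^sup>2) \<le> d * (l + 1)\<^sup>2 * (2 * d - l\<^sup>2 - l)"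
  shows "n \<le> 2 * real (dim (span (v ` I)))"
proof (rule ccontr)
  assume "\<not> ?thesis"
  then have "2 * dim (span (v ` I)) < card I" by (simp add: n_def)
  \<comment> \<open>Integrality gains one here, which accounts for the \<open>- 3\<close> in
    \<open>R\<close>.\<close>
  then have "2 * dim (span (v ` I)) + 1 \<le> card I" by simp
  then have r: "2 * real (dim (span (v ` I))) + 1 \<le> n" unfolding n_def by linarith
  define s e k R t where "s = 2 * l + 1" and "e = d - l" and "k = d - l\<^sup>2"
    and "R = (n - 3) / 2" and "t = (n + 2 * l - 2 * d) / s"
  have s: "s > 0" "s * t = n + 2 * l - 2 * d" using l by (simp_all add: s_def t_def)
  have "1 * 2 \<le> l * (l + 1)" using l by (intro mult_mono) auto
  then have b4: "b \<ge> 4" by (simp add: b_def)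
  then have "4 * 7 \<le> b * (2 * b - 1)" by (intro mult_mono) auto
  then have n28: "n \<ge> 28" using n by simp
  have l2: "l\<^sup>2 \<le> 9/4" "l \<le> l\<^sup>2"
    using l mult_mono[of l "3/2" l "3/2"] by (simp_all add: power2_eq_square)
  have "3 * s \<le> s * t"
    unfolding s(2) using n28 l2 l d by (simp add: s_def)
  then have t3: "t \<ge> 3" using s(1) by simp
  have "3 * ((n - 1) / 2) \<le> t * (1 + R)"
    using t3 n28 by (intro mult_mono) (auto simp: R_def field_simps)
  then have "n \<le> t * (1 + R)" using n28 by simp
  then have "(n - t)\<^sup>2 \<le> R * (n * D - t\<^sup>2)"
    using r t3 s(2) by (intro rank_average[OF ne avg]) (auto simp: s_def R_def field_simps)
  then have "s\<^sup>2 * (n - t)\<^sup>2 \<le> s\<^sup>2 * (R * (n * D - t\<^sup>2))"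
    by (intro mult_left_mono) auto
  also have "s\<^sup>2 * (R * (n * D - t\<^sup>2)) = R * (n * (n + 2 * b) - (s * t)\<^sup>2)"
    unfolding scaled_D[folded s_def, symmetric] by (simp add: power_mult_distrib algebra_simps)
  also have "s\<^sup>2 * (n - t)\<^sup>2 = (s * n - s * t)\<^sup>2"
    by (simp add: power_mult_distrib flip: right_diff_distrib)
  finally have "(s * n - s * t)\<^sup>2 \<le> R * (n * (n + 2 * b) - (s * t)\<^sup>2)" .
  moreover have "s * n - s * t = 2 * (l * n + e)"
    unfolding s(2) by (simp add: s_def e_def algebra_simps)
  moreover have "n * (n + 2 * b) - (s * t)\<^sup>2 = 4 * (n * (2 * l\<^sup>2 + k) - e\<^sup>2)"
    unfolding s(2) by (simp add: b_def e_def k_def power2_eq_square algebra_simps)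
  ultimately have "(2 * (l * n + e))\<^sup>2 \<le> (n - 3) / 2 * (4 * (n * (2 * l\<^sup>2 + k) - e\<^sup>2))"
    by (simp add: R_def)
  then have rank: "n * (4 * l * e + e\<^sup>2 + 6 * l\<^sup>2 + 3 * k) - e\<^sup>2 \<le> n * (n * k)"
    by (simp add: power2_eq_square field_simps)
  define x where "x = l - 1"
  have x: "l = 1 + x" "0 \<le> x" "x \<le> 1/2" using l by (simp_all add: x_def)
  have k: "0 < k" "k \<le> l / 4" "d = l\<^sup>2 + k" using d by (simp_all add: k_def)
  have "n * l * k \<le> (l\<^sup>2 + k) * (l + 1)\<^sup>2 * (l\<^sup>2 - l + 2 * k)"
    using star unfolding k(3) by (simp add: algebra_simps)
  also have "\<dots> \<le> (l\<^sup>2 + l / 4) * (l + 1)\<^sup>2 * (l\<^sup>2 - l + 2 * (l / 4))"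
    using k l l2 by (intro mult_mono mult_right_mono) auto
  also have "\<dots> = l * (l * ((l + 1/4) * (l + 1)\<^sup>2 * (l - 1/2)))"
    by (simp add: field_simps power2_eq_square)
  also have "\<dots> < l * (l * (4 * l\<^sup>2 + 2 * l))"
  proof -
    have "x\<^sup>2 \<le> (1/2)\<^sup>2" "x ^ 3 \<le> (1/2) ^ 3" "x ^ 4 \<le> (1/2) ^ 4"
      using x by (intro power_mono; simp)+
    then have "0 < 7/2 + x / 2 - 61/8 * x\<^sup>2 - 23/4 * x ^ 3 - x ^ 4"
      using x by (simp add: power_divide)
    also have "\<dots> = 4 * l\<^sup>2 + 2 * l - (l + 1/4) * (l + 1)\<^sup>2 * (l - 1/2)"
      unfolding x(1) by (simp add: field_simps power2_eq_square power3_eq_cube power4_eq_xxxx)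
    finally show ?thesis using l by simp
  qed
  finally have "l * (n * k) < l * (l * (4 * l\<^sup>2 + 2 * l))" by (simp add: mult_ac)
  then have "n * k < l * (4 * l\<^sup>2 + 2 * l)" using l by simp
  also have "\<dots> \<le> 4 * l * e + 6 * l\<^sup>2 + 3 * k"
    using k l by (simp add: e_def k(3) power2_eq_square algebra_simps)
  finally have "n * (n * k) < n * (4 * l * e + 6 * l\<^sup>2 + 3 * k)"
    using n28 by simp
  with rank have "n * e\<^sup>2 < e\<^sup>2" by (simp add: algebra_simps)
  moreover have "1 * e\<^sup>2 \<le> n * e\<^sup>2" using n28 by (intro mult_right_mono) auto
  ultimately show False by simp
qed

text \<open>Without negative products the Gram matrix is \<open>(2 l I + J) / (2 l + 1)\<close>,
  which is positive definite.\<close>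

lemma card_independent_le:
  assumes J: "J \<subseteq> I" and indep: "\<And>i j. \<lbrakk>i \<in> J; j \<in> J\<rbrakk> \<Longrightarrow> adj i j = 0"
  shows "card J \<le> dim (span (v ` I))"
proof -
  interpret J: equiangular_family J v l
  proof
    show "finite J" by (rule finite_subset[OF J fin])
    show "l > 0" by (rule l_pos)
    show "v i \<bullet> v i = 1" if "i \<in> J" for i
      using unit J that by auto
    show "\<bar>v i \<bullet> v j\<bar> = 1 / (2 * l + 1)" if "i \<in> J" "j \<in> J" "i \<noteq> j" for i j
      using J that by (intro angle) auto
  qed
  have inj: "inj_on v J"
  proof (rule inj_onI, rule ccontr)
    fix i j assume "i \<in> J" "j \<in> J" "v i = v j" "i \<noteq> j"
    then have "\<bar>1::real\<bar> = 1 / (2 * l + 1)" using J.angle[of i j] J.unit[of j] by simp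
    then show False using l_pos by (simp add: field_simps)
  qed
  have "independent (v ` J)"
  proof (rule independent_if_scalars_zero)
    fix f x assume f: "(\<Sum>x\<in>v ` J. f x *\<^sub>R x) = 0" and "x \<in> v ` J"
    then obtain i where i: "i \<in> J" "x = v i" by blast
    have "(\<Sum>j\<in>J. f (v j) *\<^sub>R v j) = 0"
      using f inj by (simp add: sum.reindex)
    then have "2 * l * (\<Sum>j\<in>J. (f (v j))\<^sup>2) + (\<Sum>j\<in>J. f (v j))\<^sup>2 = 0"
      using J.norm_combination[of "\<lambda>j. f (v j)"] indep by simp
    moreover have "0 \<le> 2 * l * (\<Sum>j\<in>J. (f (v j))\<^sup>2)" using l_pos by (simp add: sum_nonneg)
    ultimately have "2 * l * (\<Sum>j\<in>J. (f (v j))\<^sup>2) = 0"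
      by (simp only: add_nonneg_eq_0_iff zero_le_power2)
    then have "(\<Sum>j\<in>J. (f (v j))\<^sup>2) = 0" using l_pos by simp
    then show "f x = 0" using i J.fin by (simp add: sum_nonneg_eq_0_iff)
  qed (simp add: J.fin)
  then have "card (v ` J) \<le> dim (span (v ` I))"
    using J by (intro independent_card_le_dim) (auto intro: span_base)
  then show ?thesis using inj by (simp add: card_image)
qed

text \<open>For \<open>l \<le> 1\<close> the graph is a matching; for \<open>l \<ge> 3/2\<close> the
  average degree is at most \<open>l\<^sup>2\<close>; in between, the star test takes over when the
  average is larger.\<close>

lemma signed_bound:
  assumes ne: "I \<noteq> {}" and l: "l \<ge> 1/2"
    and n: "n \<ge> b * (2 * b - 1)" "l > 1/2 \<or> n > b * (2 * b - 1)"
    and u: "u \<bullet> u = 1" and eig: "(\<Sum>i\<in>I. (u \<bullet> v i) *\<^sub>R v i) = y *\<^sub>R u" and y: "y > D"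
    and signs: "\<And>i. i \<in> I \<Longrightarrow> u \<bullet> v i \<ge> 0"
  shows "n \<le> 2 * real (dim (span (v ` I)))"
    and "l \<ge> 3/2 \<Longrightarrow> n + (l + 1)\<^sup>2 / 2 < 2 * real (dim (span (v ` I)))"
proof -
  interpret G: psd_graph I adj l by (rule psd_graph_adj[OF ne])
  have deg: "G.deg i < l ^ 3 + l\<^sup>2 / 2 + l / 2" if "i \<in> I" for i
    unfolding G.deg_def using degree_less[OF l n u eig y signs that] by simp
  have avg_eq: "(\<Sum>i\<in>I. \<Sum>j\<in>I. adj i j) = sum G.deg I" by (simp add: G.deg_def)
  have n': "real (card I) \<ge> 2 * l * (l + 1) * (4 * l\<^sup>2 + 4 * l - 1)"
    using n(1) by (simp add: n_def b_def power2_eq_square algebra_simps)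
  have sparse: "n + (l + 1)\<^sup>2 / 2 < 2 * real (dim (span (v ` I)))"
    if "l > 1" "sum G.deg I \<le> n * l\<^sup>2"
    using dim_bound_sparse[OF ne that(1) n(1)] that(2) avg_eq by simp
  show large: "n + (l + 1)\<^sup>2 / 2 < 2 * real (dim (span (v ` I)))" if "l \<ge> 3/2"
    using that G.sum_deg_le[OF that n'] deg by (intro sparse) (auto simp: n_def intro: less_imp_le)
  show "n \<le> 2 * real (dim (span (v ` I)))"
  proof (cases "l \<le> 1")
    case True
    \<comment> \<open>These make the strict degree bound at most \<open>2\<close>.\<close>
    have "l ^ 3 \<le> 1" "l\<^sup>2 \<le> 1" using True l by (auto intro: power_le_one)
    then have "\<And>i. i \<in> I \<Longrightarrow> G.deg i < 2" using deg True by fastforce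
    then obtain J where "J \<subseteq> I" "card I \<le> 2 * card J" "\<And>i j. \<lbrakk>i \<in> J; j \<in> J\<rbrakk> \<Longrightarrow> adj i j = 0"
      using G.half_independent by blast
    then show ?thesis using card_independent_le[of J] by (simp add: n_def)
  next
    case False
    then have l1: "l > 1" by simp
    have weak: "n \<le> 2 * real (dim (span (v ` I)))"
      if "n + (l + 1)\<^sup>2 / 2 < 2 * real (dim (span (v ` I)))"
      using that by (smt (verit) zero_le_power2 divide_nonneg_pos)
    show ?thesis
    proof (cases "l \<ge> 3/2 \<or> sum G.deg I \<le> n * l\<^sup>2")
      case True
      then show ?thesis using weak large sparse l1 by blast
    next
      case False
      obtain j where j: "j \<in> I" "\<And>i. i \<in> I \<Longrightarrow> G.deg i \<le> G.deg j"
        using obtains_MAX[OF fin ne, of G.deg] fin by (metis Max_ge finite_imageI imageI)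
      have le: "sum G.deg I \<le> n * G.deg j"
        using sum_bounded_above[of I G.deg "G.deg j"] j by (simp add: n_def)
      have "n > 0" using ne fin by (simp add: n_def card_gt_0_iff)
      moreover have "n * l\<^sup>2 < n * G.deg j" using le False by simp
      ultimately have dj: "l\<^sup>2 < G.deg j" by simp
      have star: "n * l * (G.deg j - l\<^sup>2) \<le> G.deg j * (l + 1)\<^sup>2 * (2 * G.deg j - l\<^sup>2 - l)"
        unfolding n_def using False j by (intro G.star_test dj) (auto simp: n_def)
      have "G.deg j \<le> l\<^sup>2 + l / 4"
        using l1 n' dj deg[OF j(1)] star unfolding n_def
        by (intro star_test_gap[of l "real (card I)"]) auto
      then show ?thesis
        using dim_bound_star[OF ne _ _ n(1) dj _ _ star] l1 False le avg_eq by simp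
    qed
  qed
qed

text \<open>If \<open>v i \<bullet> v j\<close> were negative, \<open>v i + v j - v k\<close> would
  have squared norm \<open>3 - 6 * a\<close>, which is negative for \<open>a > 1/2\<close>.\<close>

lemma all_nonneg_no_adj:
  assumes l: "l < 1/2" and k: "k \<in> I" "\<And>i. i \<in> I \<Longrightarrow> v k \<bullet> v i \<ge> 0" and ij: "i \<in> I" "j \<in> I"
  shows "adj i j = 0"
proof (rule ccontr)
  assume "adj i j \<noteq> 0"
  then have neg: "i \<noteq> j" "v i \<bullet> v j < 0" by (auto simp: adj_def split: if_splits)
  define a where "a = 1 / (2 * l + 1)"
  have a: "a > 1/2" using l l_pos by (simp add: a_def field_simps)
  have "i \<noteq> k" "j \<noteq> k" using neg k ij by (auto simp: inner_commute[of _ "v k"] not_less[symmetric])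
  then have ips: "v k \<bullet> v i = a" "v k \<bullet> v j = a" "v i \<bullet> v j = - a"
    using angle[OF k(1) ij(1)] angle[OF k(1) ij(2)] angle[OF ij] k(2)[OF ij(1)] k(2)[OF ij(2)] neg
    by (auto simp: a_def)
  have "0 \<le> (v i + v j - v k) \<bullet> (v i + v j - v k)" by simp
  also have "\<dots> = 3 - 6 * a"
    using ips unit ij k(1) by (simp add: inner_diff inner_add inner_commute[of "v i" "v k"]
        inner_commute[of "v j" "v k"] inner_commute[of "v j" "v i"])
  finally show False using a by simp
qed

lemma sign_change:
  assumes sg: "\<And>i. sg i = 1 \<or> sg i = (-1::real)"
  shows "equiangular_family I (\<lambda>i. sg i *\<^sub>R v i) l" "span ((\<lambda>i. sg i *\<^sub>R v i) ` I) = span (v ` I)"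
proof -
  have abs: "\<bar>sg i\<bar> = 1" "sg i * sg i = 1" for i using sg[of i] by auto
  show "equiangular_family I (\<lambda>i. sg i *\<^sub>R v i) l"
    using fin l_pos unit angle by unfold_locales (auto simp: abs abs_mult mult.assoc[symmetric])
  have "sg i *\<^sub>R v i \<in> span (v ` I)" if "i \<in> I" for i
    using that by (intro span_scale span_base) auto
  moreover have "v i \<in> span ((\<lambda>i. sg i *\<^sub>R v i) ` I)" if "i \<in> I" for i
  proof -
    have "sg i *\<^sub>R (sg i *\<^sub>R v i) \<in> span ((\<lambda>i. sg i *\<^sub>R v i) ` I)"
      using that by (intro span_scale span_base) auto
    then show ?thesis by (simp add: abs)
  qed
  ultimately show "span ((\<lambda>i. sg i *\<^sub>R v i) ` I) = span (v ` I)"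
    by (intro subset_antisym span_minimal) auto
qed

text \<open>If the top eigenvalue \<open>y\<close> equals \<open>D\<close>, the family is tight and
  \<open>tight_case\<close> gives its dimension; otherwise signs are chosen along the top
  eigenvector for \<open>signed_bound\<close>.\<close>

lemma family_bound:
  shows "n > b * (2 * b - 1) \<Longrightarrow> n \<le> 2 * real (dim (span (v ` I)))"
    and "\<lbrakk>l \<ge> 3; n \<ge> b * (2 * b - 1)\<rbrakk> \<Longrightarrow> n = b * (2 * b - 1) \<and> real (dim (span (v ` I))) = 2 * b - 1
      \<or> n + (l + 1)\<^sup>2 / 2 < 2 * real (dim (span (v ` I)))"
proof -
  have *: "n = b * (2 * b - 1) \<and> real (dim (span (v ` I))) = 2 * b - 1 \<or>
      n \<le> 2 * real (dim (span (v ` I))) \<and>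
      (l \<ge> 3/2 \<longrightarrow> n + (l + 1)\<^sup>2 / 2 < 2 * real (dim (span (v ` I))))"
    if l: "l \<ge> 1/2" and n: "n \<ge> b * (2 * b - 1)" "l > 1/2 \<or> n > b * (2 * b - 1)"
  proof -
    obtain u y where u: "norm u = 1" and bound: "\<And>w. (\<Sum>i\<in>I. (w \<bullet> v i)\<^sup>2) \<le> y * (w \<bullet> w)"
      and y: "(\<Sum>i\<in>I. (u \<bullet> v i)\<^sup>2) = y"
      using max_quadratic_form_exists[of v I] by metis
    have uu: "u \<bullet> u = 1" using u by (simp add: dot_square_norm)
    have eig: "(\<Sum>i\<in>I. (u \<bullet> v i) *\<^sub>R v i) = y *\<^sub>R u"
      using y uu by (intro maximizer_is_eigenvector bound) simp
    have b: "b \<ge> 3/2"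
      using l mult_mono[of "1/2" l "3/2" "l + 1"] by (simp add: b_def)
    then have "3/2 * 2 \<le> b * (2 * b - 1)" by (intro mult_mono) auto
    then have n3: "n \<ge> 3" using n by simp
    then have ne: "I \<noteq> {}" by (auto simp: n_def)
    show ?thesis
    proof (cases "y = D")
      case True
      have s: "(2 * l + 1)\<^sup>2 = 2 * b + 1" by (simp add: b_def power2_eq_square algebra_simps)
      have D: "(2 * b + 1) * D = n + 2 * b" using scaled_D s by simp
      have "(2 * b + 1) * D < (2 * b + 1) * n"
        unfolding D using n3 b by (simp add: algebra_simps)
      then have Dn: "D < n" using b by simp
      \<comment> \<open>For \<open>y = D\<close> the cubic factors and leaves
        \<open>D \<le> b\<close>, which is equivalent to
        \<open>n \<le> b * (2 * b - 1)\<close>.\<close>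
      have "D * D * (n - D) \<le> b * D * (n - D)"
        using eigenvalue_cubic[OF uu eig] True by (simp add: power3_eq_cube algebra_simps)
      then have "D \<le> b" using Dn D_pos by simp
      then have "(2 * b + 1) * D \<le> (2 * b + 1) * b" using b by (intro mult_left_mono) auto
      then have "n \<le> b * (2 * b - 1)" unfolding D by (simp add: algebra_simps)
      then have n_eq: "n = b * (2 * b - 1)" using n by simp
      have "(2 * b + 1) * D = (2 * b + 1) * b" unfolding D n_eq by (simp add: algebra_simps)
      then have "D = b" using b by simp
      then have "b * real (dim (span (v ` I))) = b * (2 * b - 1)"
        using tight_case bound True n_eq by simp
      then have "real (dim (span (v ` I))) = 2 * b - 1" using b by simp
      then show ?thesis using n_eq by simp
    next
      case False
      then have yD: "y > D" using form_max_ge[OF bound ne] by simp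
      define sg :: "'i \<Rightarrow> real" where "sg i = (if u \<bullet> v i \<ge> 0 then 1 else -1)" for i
      have sg: "sg i = 1 \<or> sg i = -1" for i by (simp add: sg_def)
      interpret V: equiangular_family I "\<lambda>i. sg i *\<^sub>R v i" l by (rule sign_change[OF sg])
      have signs: "(u \<bullet> (sg i *\<^sub>R v i)) *\<^sub>R (sg i *\<^sub>R v i) = (u \<bullet> v i) *\<^sub>R v i" for i
        using sg[of i] by auto
      have eig': "(\<Sum>i\<in>I. (u \<bullet> (sg i *\<^sub>R v i)) *\<^sub>R (sg i *\<^sub>R v i)) = y *\<^sub>R u"
        using eig by (simp only: signs)
      have "u \<bullet> (sg i *\<^sub>R v i) \<ge> 0" for i by (simp add: sg_def)
      from V.signed_bound[OF ne l n uu eig' yD this] show ?thesis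
        by (simp add: sign_change(2)[OF sg])
    qed
  qed
  show "n = b * (2 * b - 1) \<and> real (dim (span (v ` I))) = 2 * b - 1
      \<or> n + (l + 1)\<^sup>2 / 2 < 2 * real (dim (span (v ` I)))" if "l \<ge> 3" "n \<ge> b * (2 * b - 1)"
    using * that by auto
  show "n \<le> 2 * real (dim (span (v ` I)))" if n: "n > b * (2 * b - 1)"
  proof (cases "l \<ge> 1/2 \<or> I = {}")
    case True
    then show ?thesis using * n by (auto simp: n_def)
  next
    case False
    then obtain k where k: "k \<in> I" by auto
    \<comment> \<open>For \<open>l < 1/2\<close>, signs relative to the single vector
      \<open>v k\<close> leave no negative products, so the whole family is independent.\<close>
    define sg :: "'i \<Rightarrow> real" where "sg i = (if v k \<bullet> v i \<ge> 0 then 1 else -1)" for i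
    have sg: "sg i = 1 \<or> sg i = -1" for i by (simp add: sg_def)
    interpret V: equiangular_family I "\<lambda>i. sg i *\<^sub>R v i" l by (rule sign_change[OF sg])
    have "sg k = 1" by (simp add: sg_def)
    then have "sg k *\<^sub>R v k \<bullet> sg i *\<^sub>R v i \<ge> 0" for i by (simp add: sg_def)
    then have "V.adj i j = 0" if "i \<in> I" "j \<in> I" for i j
      using False that by (intro V.all_nonneg_no_adj[OF _ k]) auto
    then have "card I \<le> dim (span (v ` I))"
      using V.card_independent_le[of I] by (simp add: sign_change(2)[OF sg])
    then show ?thesis by (simp add: n_def)
  qed
qed

end

section \<open>Passing from unit vectors back to lines\<close>

lemma line_eq_span:
  fixes m :: "(real ^ 'r) set"
  assumes "subspace m" "dim m = 1" "x \<in> m" "norm x = 1"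
  shows "m = span {x}"
proof -
  have "x \<noteq> 0" using assms(4) by auto
  then have "dim (span {x}) = 1" by simp
  then show ?thesis
    using assms subspace_dim_equal[of "span {x}" m] by (simp add: span_minimal)
qed

lemma equiangular_lines_bound:
  fixes L :: "(real ^ 'r) set set" and \<alpha> B d :: real
  assumes \<alpha>: "0 < \<alpha>" "\<alpha> < 1" and L: "equiangular_lines \<alpha> L"
  defines "B \<equiv> (1 / \<alpha>\<^sup>2 - 1) gchoose 2" and "d \<equiv> real (dim (span (\<Union>L)))"
  shows "card L > B \<Longrightarrow> card L \<le> 2 * d"
    and "\<lbrakk>\<alpha> \<le> 1 / 7; card L \<ge> B\<rbrakk> \<Longrightarrow> card L = B \<and> d = 1 / \<alpha>\<^sup>2 - 2
      \<or> card L + (1 + \<alpha>)\<^sup>2 / (8 * \<alpha>\<^sup>2) < 2 * d"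
proof -
  \<comment> \<open>The solution of \<open>1 / (2 * l + 1) = \<alpha>\<close>; it turns
    \<open>\<alpha> \<le> 1 / 7\<close> into \<open>l \<ge> 3\<close>.\<close>
  define l where "l = (1 - \<alpha>) / (2 * \<alpha>)"
  have l: "l > 0" "1 / (2 * l + 1) = \<alpha>" using \<alpha> by (simp_all add: l_def field_simps)
  have lines: "subspace m" "dim m = 1" if "m \<in> L" for m
    using L that by (auto simp: equiangular_lines_def)
  then have "\<forall>m\<in>L. \<exists>x\<in>m. norm x = 1" using unit_vector_exists by blast
  then obtain v where v: "\<And>m. m \<in> L \<Longrightarrow> v m \<in> m" "\<And>m. m \<in> L \<Longrightarrow> norm (v m) = 1"
    by metis
  interpret equiangular_family L v l
  proof
    show "finite L" using L by (simp add: equiangular_lines_def)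
    show "l > 0" by (rule l(1))
    show "v i \<bullet> v i = 1" if "i \<in> L" for i
      using v(2)[OF that] by (simp add: dot_square_norm)
    show "\<bar>v i \<bullet> v j\<bar> = 1 / (2 * l + 1)" if "i \<in> L" "j \<in> L" "i \<noteq> j" for i j
      using L that v unfolding equiangular_lines_def l(2) by blast
  qed
  have "span (\<Union>L) = span (v ` L)"
  proof (intro subset_antisym span_minimal subspace_span subsetI)
    fix x assume "x \<in> \<Union>L"
    then obtain m where m: "m \<in> L" "x \<in> m" by blast
    then have "x \<in> span {v m}" using line_eq_span[OF lines v] by blast
    also have "\<dots> \<subseteq> span (v ` L)" using m by (intro span_mono) auto
    finally show "x \<in> span (v ` L)" .
  qed (use v in \<open>auto intro: span_base\<close>)
  then have d: "real (dim (span (v ` L))) = d" by (simp add: d_def)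
  have b: "2 * b = 1 / \<alpha>\<^sup>2 - 1"
    unfolding b_def unfolding l_def using \<alpha> by (simp add: field_simps power2_eq_square)
  then have B: "b * (2 * b - 1) = B"
    unfolding B_def b[symmetric] gchoose_2_real by (simp add: field_simps)
  have e: "(l + 1)\<^sup>2 / 2 = (1 + \<alpha>)\<^sup>2 / (8 * \<alpha>\<^sup>2)"
    using \<alpha> by (simp add: l_def field_simps power2_eq_square)
  show "card L > B \<Longrightarrow> card L \<le> 2 * d"
    using family_bound(1) unfolding B d n_def .
  assume "\<alpha> \<le> 1 / 7" "card L \<ge> B"
  then have "l \<ge> 3" using \<alpha> by (simp add: l_def field_simps)
  then show "card L = B \<and> d = 1 / \<alpha>\<^sup>2 - 2 \<or> card L + (1 + \<alpha>)\<^sup>2 / (8 * \<alpha>\<^sup>2) < 2 * d"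
    using family_bound(2)[unfolded B d e n_def] \<open>card L \<ge> B\<close> b by auto
qed

theorem theorem1p2:
  fixes \<alpha> :: real
  assumes "0 < \<alpha>" and "\<alpha> < 1"
  shows "real (max_equiangular TYPE('r::finite) \<alpha>)
           \<le> max ((1 / \<alpha>\<^sup>2 - 1) gchoose 2) (2 * real CARD('r)) \<and>
         (\<alpha> \<le> 1 / 7 \<longrightarrow>
           (real CARD('r) \<le> r_alpha \<alpha> \<longrightarrow>
              real (max_equiangular TYPE('r) \<alpha>) \<le> ((1 / \<alpha>\<^sup>2 - 1) gchoose 2) \<and>
              (real (max_equiangular TYPE('r) \<alpha>) = ((1 / \<alpha>\<^sup>2 - 1) gchoose 2) \<longrightarrow>
                 (\<forall>L :: (real ^ 'r) set set.
                    equiangular_lines \<alpha> L \<and> card L = max_equiangular TYPE('r) \<alpha> \<longrightarrow>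
                    real (dim (span (\<Union>L))) = 1 / \<alpha>\<^sup>2 - 2))) \<and>
           (real CARD('r) > r_alpha \<alpha> \<longrightarrow>
              real (max_equiangular TYPE('r) \<alpha>)
                \<le> 2 * real CARD('r) - (1 + \<alpha>)\<^sup>2 / (8 * \<alpha>\<^sup>2)))"
proof -
  define B E where "B = (1 / \<alpha>\<^sup>2 - 1) gchoose 2" and "E = (1 + \<alpha>)\<^sup>2 / (8 * \<alpha>\<^sup>2)"
  define r where "r = real CARD('r)"
  \<comment> \<open>At \<open>r = r_alpha \<alpha>\<close> the bounds \<open>B\<close> and
    \<open>2 * r - E\<close> agree. Up to there, \<open>card M + E < 2 * r\<close> is incompatible
    with \<open>card M \<ge> B\<close>; beyond it, a family of size at most \<open>B\<close> also
    stays below \<open>2 * r - E\<close>.\<close>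
  have r_alpha: "2 * r_alpha \<alpha> = B + E"
    by (simp add: r_alpha_def B_def E_def)
  have dim_le: "real (dim (span (\<Union>L))) \<le> r" for L :: "(real ^ 'r) set set"
    using dim_subset_UNIV_cart[of "span (\<Union>L)"] by (simp add: r_def)
  obtain L :: "(real ^ 'r) set set"
    where L: "equiangular_lines \<alpha> L" "card L = max_equiangular TYPE('r) \<alpha>"
    using max_equiangular_attained[OF assms(2)] by blast
  have general: "real (card L) \<le> max B (2 * r)"
    using equiangular_lines_bound(1)[OF assms L(1)] dim_le[of L] unfolding B_def by fastforce
  have small: "card M = B \<and> real (dim (span (\<Union>M))) = 1 / \<alpha>\<^sup>2 - 2 \<or> card M + E < 2 * r"
    if "\<alpha> \<le> 1 / 7" "card M \<ge> B" "equiangular_lines \<alpha> M" for M :: "(real ^ 'r) set set"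
    using equiangular_lines_bound(2)[OF assms that(3,1)] that(2) dim_le[of M]
    unfolding B_def E_def by fastforce
  have "real (card L) \<le> B" if "\<alpha> \<le> 1 / 7" "r \<le> r_alpha \<alpha>"
    using small[OF that(1) _ L(1)] that(2) r_alpha by linarith
  moreover have "real (dim (span (\<Union>M))) = 1 / \<alpha>\<^sup>2 - 2"
    if "\<alpha> \<le> 1 / 7" "r \<le> r_alpha \<alpha>" "card M = B" "equiangular_lines \<alpha> M" for M :: "(real ^ 'r) set set"
    using small[OF that(1) _ that(4)] that(2,3) r_alpha by linarith
  moreover have "real (card L) \<le> 2 * r - E" if "\<alpha> \<le> 1 / 7" "r > r_alpha \<alpha>"
    using small[OF that(1) _ L(1)] that(2) r_alpha by linarith
  ultimately show ?thesis
    using general unfolding L(2) B_def E_def r_def by metis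
qed

end
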